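(* Let $(\mathbb S,+,\cdot,0,1)$ be a zero-sum free commutative semiring and $\Sigma$ a ranked alphabet. For all weighted tree automata with constraints (WTAc) $G$ and $G'$ over $\mathbb S$ and $\Sigma$ there exists a WTAc $H$ over $\mathbb S$ and $\Sigma$ such that $H=G|_{\mathrm{supp}(G')}$ as weighted tree languages. Likewise, for all classic WTAc $G$ and $G'$ there exists a classic WTAc $H$ such that $H=G|_{\mathrm{supp}(G')}$. Here, for $A,A'\in\mathbb S^{T_\Sigma}$, $A|_{\mathrm{supp}(A')}(t)=A_t$ if $t\in\mathrm{supp}(A')$ and $A|_{\mathrm{supp}(A')}(t)=0$ otherwise.
   Context: Trees: $\mathbb N=\{0,1,2,\dots\}$, $[k]=\{1,\dots,k\}$. A ranked alphabet $\Sigma$ is a finite set with a rank map $\mathrm{rk}\colon\Sigma\to\mathbb N$; $\Sigma_k=\mathrm{rk}^{-1}(k)$. $T_\Sigma(Z)$ is the smallest set containing $Z$ (disjoint from $\Sigma$) and $\sigma(t_1,\dots,t_k)$ for all $\sigma\in\Sigma_k$, $t_1,\dots,t_k\in T_\Sigma(Z)$; $T_\Sigma=T_\Sigma(\emptyset)$. Positions: $\mathrm{pos}(z)=\{\varepsilon\}$ for $z \in Z$ and $\mathrm{pos}(\sigma(t_1,\dots,t_k))=\{\varepsilon\}\cup\{iw\mid i\in[k],w\in\mathrm{pos}(t_i)\}$. $t(w)$, $t|_w$, $t[t']_w$ denote the label at $w$, the subtree at $w$, and the replacement of the subtree at $w$ by $t'$. $\mathrm{pos}_S(t)=\{w\in\mathrm{pos}(t)\mid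 t(w)\in S\}$. Commutative semiring: $(\mathbb S,+,0)$ and $(\mathbb S,\cdot,1)$ are commutative monoids, $\cdot$ distributes over $+$, and $0\cdot s=0$. It is zero-sum free if $s+s'=0$ implies $s=0=s'$. A weighted tree language over $\mathbb S$ is a map $A\colon T_\Sigma\to\mathbb S$, $t\mapsto A_t$, with support $\mathrm{supp}(A)=\{t\mid A_t\neq0\}$. A weighted tree grammar with constraints (WTGc) over $\mathbb S$ is a tuple $G=(Q,\Sigma,F,P,\mathrm{wt})$ with a finite set $Q$ of nonterminals, final weights $F\in\mathbb S^Q$, a ranked alphabet $\Sigma$, a finite set $P$ of productions $(\ell,q,E,I)$, written $\ell\xrightarrow{E,I}q$, where $\ell\in T_\Sigma(Q)\setminus Q$, $q\in Q$, and $E,I\subseteq\mathbb N^*\times\mathbb N^*$ are finite (equality and inequality constraints), and $\mathrm{wt}\in\mathbb S^P$. A tree $t\in T_\Sigma$ satisfies $(v,v')$ if $v,v'\in\mathrm{pos}(t)$ and $t|_v=t|_{v'}$, otherwise it dissatisfies it. For $\xi,\zeta\in T_\Sigma(Q)$, $\xi\Rightarrow^{p,w}_{G,t}\zeta$ holds for $p=\ell\xrightarrow{E,I}q$ and $w\in\mathrm{pos}(\xi)$ if $\xi|_w=\ell$, $\zeta=\xi[q]_w$, $t|_w$ satisfies all pairs in $E$ and dissatisfies all pairs in $I$. $D^q_G(t)$ is the set of complete left-most derivations for $t$ to $q$, i.e. sequences $d=(p_1,w_1)\cdots(p_n,w_n)$ with $t\Rightarrow^{p_1,w_1}_{G,t}\xi_1\Rightarrow\cdots\Rightarrow^{p_n,w_n}_{G,t}\xi_n=q$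 and $w_1\prec\cdots\prec w_n$, where $\preceq$ is the lexicographic order on $\mathbb N^*$ in which prefixes are larger (so $\varepsilon$ is largest). $\mathrm{wt}_G(d)=\prod_i\mathrm{wt}(p_i)$. $G$ generates the weighted tree language $G_t=\sum_{q\in Q,\,d\in D_G^q(t)}F_q\cdot\mathrm{wt}_G(d)$. A WTGc is a WTAc if every production is normalized, i.e. has left-hand side $\ell=\sigma(q_1,\dots,q_k)$ with $\sigma\in\Sigma_k$ and $q_i\in Q$. It is classic if $v,v'\in\mathrm{pos}_Q(\ell)$ for every production $\ell\xrightarrow{E,I}q$ and all $(v,v')\in E\cup I$. *)

theory Defs
  imports Main
begin

section \<open>Trees\<close>

text \<open>
  The set \<open>T\<^sub>\<Sigma>(Z)\<close> is a subset of the following type; ranks are enforced by \<open>trees\<close> below.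
  Symbols and elements of \<open>Z\<close> are disjoint because they are tagged by different constructors.
\<close>

datatype ('f, 'z) tree = Var 'z | Fun 'f "('f, 'z) tree list"

inductive_set trees :: "'f set \<Rightarrow> ('f \<Rightarrow> nat) \<Rightarrow> 'z set \<Rightarrow> ('f, 'z) tree set"
  for Sig :: "'f set" and rk :: "'f \<Rightarrow> nat" and Z :: "'z set" where
  Var: "z \<in> Z \<Longrightarrow> Var z \<in> trees Sig rk Z"
| Fun: "f \<in> Sig \<Longrightarrow> length ts = rk f \<Longrightarrow> (\<And>t. t \<in> set ts \<Longrightarrow> t \<in> trees Sig rk Z) \<Longrightarrow>
    Fun f ts \<in> trees Sig rk Z"

text \<open>
  Trees in \<open>T\<^sub>\<Sigma> = T\<^sub>\<Sigma>(\<emptyset>)\<close> contain no \<open>Var\<close>, so the type of the variables is irrelevant for them.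
  It is fixed to \<open>unit\<close>, so that tree languages of grammars with different types of nonterminals
  have the same domain. The function \<open>embed\<close> is the inclusion of \<open>T\<^sub>\<Sigma>\<close> into \<open>T\<^sub>\<Sigma>(Q)\<close>; its value
  on variables is never used.
\<close>

abbreviation ground_trees :: "'f set \<Rightarrow> ('f \<Rightarrow> nat) \<Rightarrow> ('f, unit) tree set" where
  "ground_trees Sig rk \<equiv> trees Sig rk {}"

definition embed :: "('f, unit) tree \<Rightarrow> ('f, 'z) tree" where
  "embed = map_tree id (\<lambda>_. undefined)"

type_synonym position = "nat list"

text \<open>Children are numbered from 1, whereas list indices start at 0.\<close>

function pos :: "('f, 'z) tree \<Rightarrow> position set" where
  "pos (Var z) = {[]}"
| "pos (Fun f ts) = {[]} \<union> (\<Union>i\<in>{1..length ts}. {i # w |w. w \<in> pos (ts ! (i - 1))})"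
  by pat_completeness auto
termination
proof (relation "measure size", simp)
  fix f :: 'f and ts :: "('f, 'z) tree list" and i assume "i \<in> {1..length ts}"
  then have "ts ! (i - 1) \<in> set ts" by auto
  then show "(ts ! (i - 1), Fun f ts) \<in> measure size"
    by (auto dest: size_list_estimation'[where f = size, OF _ order_refl])
qed

text \<open>The functions \<open>subtree_at\<close> and \<open>replace_at\<close> are only meaningful for \<open>w \<in> pos t\<close>.\<close>

fun subtree_at :: "('f, 'z) tree \<Rightarrow> position \<Rightarrow> ('f, 'z) tree" where
  "subtree_at t [] = t"
| "subtree_at (Fun f ts) (i # w) = subtree_at (ts ! (i - 1)) w"

fun replace_at :: "('f, 'z) tree \<Rightarrow> position \<Rightarrow> ('f, 'z) tree \<Rightarrow> ('f, 'z) tree" where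
  "replace_at t [] s = s"
| "replace_at (Fun f ts) (i # w) s = Fun f (ts[i - 1 := replace_at (ts ! (i - 1)) w s])"

fun root_label :: "('f, 'z) tree \<Rightarrow> 'f + 'z" where
  "root_label (Var z) = Inr z"
| "root_label (Fun f ts) = Inl f"

definition pos_in :: "('f + 'z) set \<Rightarrow> ('f, 'z) tree \<Rightarrow> position set" where
  "pos_in S t = {w \<in> pos t. root_label (subtree_at t w) \<in> S}"

text \<open>Lexicographic order in which prefixes are larger.\<close>

definition precedes :: "position \<Rightarrow> position \<Rightarrow> bool" where
  "precedes v w \<longleftrightarrow>
     (\<exists>u. u \<noteq> [] \<and> v = w @ u) \<or>
     (\<exists>u i j v' w'. v = u @ i # v' \<and> w = u @ j # w' \<and> i < j)"


section \<open>Weighted tree grammars with constraints\<close>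

type_synonym constraint = "position \<times> position"

datatype ('q, 'f) production =
  Production (lhs: "('f, 'q) tree") (target: 'q) (eqs: "constraint set") (neqs: "constraint set")

text \<open>
  The functions \<open>final\<close> and \<open>weight\<close> are only used on \<open>nonterms\<close> and \<open>prods\<close>, respectively.
  The ranked alphabet is passed as the separate parameters \<open>Sig\<close> and \<open>rk\<close>.
\<close>

record ('q, 'f, 's) grammar =
  nonterms :: "'q set"
  final :: "'q \<Rightarrow> 's"
  prods :: "('q, 'f) production set"
  weight :: "('q, 'f) production \<Rightarrow> 's"

definition wtgc :: "'f set \<Rightarrow> ('f \<Rightarrow> nat) \<Rightarrow> ('q, 'f, 's) grammar \<Rightarrow> bool" where
  "wtgc Sig rk G \<longleftrightarrow> finite (nonterms G) \<and> finite (prods G) \<and>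
     (\<forall>p\<in>prods G. lhs p \<in> trees Sig rk (nonterms G) - Var ` nonterms G \<and>
        target p \<in> nonterms G \<and> finite (eqs p) \<and> finite (neqs p))"

definition satisfies :: "('f, 'z) tree \<Rightarrow> constraint \<Rightarrow> bool" where
  "satisfies t c \<longleftrightarrow>
     (case c of (v, v') \<Rightarrow> v \<in> pos t \<and> v' \<in> pos t \<and> subtree_at t v = subtree_at t v')"

definition step :: "('q, 'f, 's) grammar \<Rightarrow> ('f, 'q) tree \<Rightarrow> ('q, 'f) production \<Rightarrow> position \<Rightarrow>
    ('f, 'q) tree \<Rightarrow> ('f, 'q) tree \<Rightarrow> bool" where
  "step G t p w \<xi> \<zeta> \<longleftrightarrow> p \<in> prods G \<and> w \<in> pos \<xi> \<and> subtree_at \<xi> w = lhs p \<and>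
     \<zeta> = replace_at \<xi> w (Var (target p)) \<and>
     (\<forall>c\<in>eqs p. satisfies (subtree_at t w) c) \<and>
     (\<forall>c\<in>neqs p. \<not> satisfies (subtree_at t w) c)"

fun derives :: "('q, 'f, 's) grammar \<Rightarrow> ('f, 'q) tree \<Rightarrow> ('f, 'q) tree \<Rightarrow>
    (('q, 'f) production \<times> position) list \<Rightarrow> ('f, 'q) tree \<Rightarrow> bool" where
  "derives G t \<xi> [] \<zeta> \<longleftrightarrow> \<xi> = \<zeta>"
| "derives G t \<xi> ((p, w) # d) \<zeta> \<longleftrightarrow> (\<exists>\<xi>'. step G t p w \<xi> \<xi>' \<and> derives G t \<xi>' d \<zeta>)"

definition leftmost_derivations :: "('q, 'f, 's) grammar \<Rightarrow> 'q \<Rightarrow> ('f, 'q) tree \<Rightarrow>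
    (('q, 'f) production \<times> position) list set" where
  "leftmost_derivations G q t =
     {d. derives G t t d (Var q) \<and> sorted_wrt precedes (map snd d)}"

definition derivation_weight :: "('q, 'f, 's::monoid_mult) grammar \<Rightarrow>
    (('q, 'f) production \<times> position) list \<Rightarrow> 's" where
  "derivation_weight G d = (\<Prod>(p, w)\<leftarrow>d. weight G p)"

definition generated :: "('q, 'f, 's::{comm_semiring_0, comm_monoid_mult}) grammar \<Rightarrow>
    ('f, unit) tree \<Rightarrow> 's" where
  "generated G t = (\<Sum>q\<in>nonterms G. \<Sum>d\<in>leftmost_derivations G q (embed t).
     final G q * derivation_weight G d)"

definition normalized :: "'f set \<Rightarrow> ('f \<Rightarrow> nat) \<Rightarrow> 'q set \<Rightarrow> ('q, 'f) production \<Rightarrow> bool" where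
  "normalized Sig rk Q p \<longleftrightarrow>
     (\<exists>f qs. f \<in> Sig \<and> length qs = rk f \<and> set qs \<subseteq> Q \<and> lhs p = Fun f (map Var qs))"

definition wtac :: "'f set \<Rightarrow> ('f \<Rightarrow> nat) \<Rightarrow> ('q, 'f, 's) grammar \<Rightarrow> bool" where
  "wtac Sig rk G \<longleftrightarrow> wtgc Sig rk G \<and> (\<forall>p\<in>prods G. normalized Sig rk (nonterms G) p)"

definition classic :: "('q, 'f, 's) grammar \<Rightarrow> bool" where
  "classic G \<longleftrightarrow> (\<forall>p\<in>prods G. \<forall>(v, v')\<in>eqs p \<union> neqs p.
     v \<in> pos_in (Inr ` nonterms G) (lhs p) \<and> v' \<in> pos_in (Inr ` nonterms G) (lhs p))"


section \<open>Weighted tree languages\<close>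

definition supp :: "'f set \<Rightarrow> ('f \<Rightarrow> nat) \<Rightarrow> (('f, unit) tree \<Rightarrow> 's::zero) \<Rightarrow> ('f, unit) tree set" where
  "supp Sig rk A = {t \<in> ground_trees Sig rk. A t \<noteq> 0}"

definition restrict_to :: "(('f, unit) tree \<Rightarrow> 's::zero) \<Rightarrow> ('f, unit) tree set \<Rightarrow>
    ('f, unit) tree \<Rightarrow> 's" where
  "restrict_to A L t = (if t \<in> L then A t else 0)"


section \<open>Finiteness of the sums\<close>

text \<open>
  Since \<open>sum\<close> is 0 on infinite sets, \<open>generated\<close> is only adequate because there are finitely
  many left-most derivations for every tree.
\<close>

lemma precedes_irrefl: "\<not> precedes w w"
  by (auto simp: precedes_def)

lemma finite_pos: "finite (pos t)"
proof (induction t rule: pos.induct)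
  case (2 f ts)
  have "finite {i # w |w. w \<in> pos (ts ! (i - 1))}" if "i \<in> {1..length ts}" for i
    using 2[OF that] by (simp add: setcompr_eq_image)
  then show ?case by simp
qed simp

lemma pos_replace_at:
  assumes "w \<in> pos t"
  shows "pos (replace_at t w (Var z)) \<subseteq> pos t"
  using assms
proof (induction t w "Var z :: ('a, 'b) tree" rule: replace_at.induct)
  case (1 t)
  then show ?case by (cases t) auto
next
  case (2 f ts i w)
  then have i: "1 \<le> i" "i \<le> length ts" and w: "w \<in> pos (ts ! (i - 1))" by auto
  have "pos (replace_at (ts ! (i - 1)) w (Var z)) \<subseteq> pos (ts ! (i - 1))"
    using 2 w by blast
  then show ?case using i
    by (fastforce simp: nth_list_update split: if_splits)
qed auto

lemma derives_pos:
  "derives G t \<xi> d \<zeta> \<Longrightarrow> set d \<subseteq> prods G \<times> pos \<xi>"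
proof (induction d arbitrary: \<xi>)
  case (Cons a d)
  obtain p w where a: "a = (p, w)" by (cases a)
  obtain \<xi>' where s: "step G t p w \<xi> \<xi>'" and d: "derives G t \<xi>' d \<zeta>"
    using Cons.prems a by auto
  have "pos \<xi>' \<subseteq> pos \<xi>" using s by (metis pos_replace_at step_def)
  then show ?case using Cons.IH[OF d] s a by (auto simp: step_def)
qed simp

lemma finite_leftmost_derivations:
  fixes G :: "('a, 'b, 'c) grammar"
  assumes "finite (prods G)"
  shows "finite (leftmost_derivations G q t)"
proof (rule finite_subset)
  have "distinct d" if "sorted_wrt precedes (map snd d)" for d :: "(('a, 'b) production \<times> position) list"
    using that by (induction d) (auto simp: precedes_irrefl)
  then show "leftmost_derivations G q t \<subseteq> {d. distinct d \<and> set d \<subseteq> prods G \<times> pos t}"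
    by (auto simp: leftmost_derivations_def dest: derives_pos)
  show "finite {d. distinct d \<and> set d \<subseteq> prods G \<times> pos t}"
    using finite_subset_distinct[of "prods G \<times> pos t"] assms finite_pos
    by (auto intro: rev_finite_subset)
qed

end

theory Submission
  imports Defs "HOL-Library.Countable_Set" "HOL.Topological_Spaces"
begin

text \<open>
  Since the semiring is zero-sum free, \<open>G'\<close> assigns a nonzero weight to \<open>t\<close> iff \<open>F\<^sub>r \<cdot> x \<noteq> 0\<close> for some
  nonterminal \<open>r\<close> and the weight \<open>x\<close> of some derivation of \<open>t\<close> to \<open>r\<close>. All these weights lie in the
  multiplicative monoid \<open>M\<close> generated by the finitely many weights of \<open>G'\<close>, and whether a product with
  \<open>x\<close> vanishes depends only on the annihilator of \<open>x\<close> in \<open>M\<close>. By Dickson's lemma there are only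
  finitely many annihilators of elements of \<open>M\<close>. Hence the profile of \<open>t\<close>, the set of all pairs of
  \<open>r\<close> and the annihilator of \<open>x\<close> as above, takes finitely many values. The profile of
  \<open>\<sigma>(t\<^sub>1, \<dots>, t\<^sub>k)\<close> is determined by \<open>\<sigma>\<close>, the profiles of the \<open>t\<^sub>i\<close> and the set of satisfied
  constraints. So \<open>H\<close> simulates \<open>G\<close> on pairs of a nonterminal and a profile, where each production
  guesses the set \<open>C\<close> of satisfied constraints and verifies it with the equality constraints \<open>C\<close> and all
  other constraints as inequality constraints.
\<close>

section \<open>Derivations of normalized grammars\<close>

definition shift :: "nat \<Rightarrow> ('a \<times> position) list \<Rightarrow> ('a \<times> position) list" where
  "shift i d = map (\<lambda>(p, w). (p, i # w)) d"

text \<open>Left-most derivations treat the subtrees from left to right, which fixes the order of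
  concatenation. List index \<open>i\<close> belongs to child \<open>Suc i\<close>, since positions
  count from 1.\<close>

definition join :: "('a \<times> position) list list \<Rightarrow> ('a \<times> position) list" where
  "join ds = concat (map (\<lambda>i. shift (Suc i) (ds ! i)) [0..<length ds])"

text \<open>Serves as the inverse of \<open>join\<close>; the two directions are
  \<open>child_part_join\<close> and, for sorted lists, \<open>join_child_part\<close>.\<close>

fun child_part :: "nat \<Rightarrow> ('a \<times> position) list \<Rightarrow> ('a \<times> position) list" where
  "child_part i [] = []"
| "child_part i ((p, []) # d) = child_part i d"
| "child_part i ((p, j # w) # d) = (if i = j then (p, w) # child_part i d else child_part i d)"

lemma precedes_Nil_left [simp]: "\<not> precedes [] w"
  by (simp add: precedes_def)

lemma precedes_Nil_right [simp]: "precedes w [] \<longleftrightarrow> w \<noteq> []"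
  by (simp add: precedes_def)

text \<open>This recursive form of the order reduces sortedness of a derivation to sortedness below
  each child.\<close>

lemma precedes_Cons_Cons [simp]:
  "precedes (i # v) (j # w) \<longleftrightarrow> i < j \<or> i = j \<and> precedes v w"
proof
  assume "precedes (i # v) (j # w)"
  then consider u where "u \<noteq> []" "i # v = (j # w) @ u"
    | u a b v' w' where "i # v = u @ a # v'" "j # w = u @ b # w'" "a < b"
    unfolding precedes_def by blast
  then show "i < j \<or> i = j \<and> precedes v w"
  proof cases
    case 2
    then show ?thesis by (cases u) (auto simp: precedes_def)
  qed (auto simp: precedes_def)
next
  assume "i < j \<or> i = j \<and> precedes v w"
  then consider "i < j" | u where "i = j" "u \<noteq> []" "v = w @ u"
    | u a b v' w' where "i = j" "v = u @ a # v'" "w = u @ b # w'" "a < b"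
    unfolding precedes_def by blast
  then show "precedes (i # v) (j # w)"
  proof cases
    case 1
    then show ?thesis
      unfolding precedes_def by (intro disjI2 exI[of _ "[]"]) auto
  next
    case 2
    then show ?thesis by (auto simp: precedes_def)
  next
    case 3
    then show ?thesis
      unfolding precedes_def by (intro disjI2 exI[of _ "i # u"]) auto
  qed
qed

lemma child_part_append [simp]: "child_part i (d @ e) = child_part i d @ child_part i e"
  by (induction i d rule: child_part.induct) auto

lemma child_part_shift: "child_part i (shift j d) = (if i = j then d else [])"
  by (induction d) (auto simp: shift_def)

lemma child_part_join:
  assumes "i < length ds"
  shows "child_part (Suc i) (join ds) = ds ! i"
proof -
  have "child_part (Suc i) (concat (map (\<lambda>i. shift (Suc i) (ds ! i)) [0..<n]))
      = (if i < n then ds ! i else [])" for n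
    by (induction n) (auto simp: child_part_shift less_Suc_eq)
  then show ?thesis using assms by (simp add: join_def)
qed

lemma set_child_part: "(p, w) \<in> set (child_part i d) \<longleftrightarrow> (p, i # w) \<in> set d"
  by (induction i d rule: child_part.induct) auto

lemma sorted_child_part:
  "sorted_wrt precedes (map snd d) \<Longrightarrow> sorted_wrt precedes (map snd (child_part i d))"
proof (induction i d rule: child_part.induct)
  case (3 i p j w d)
  have "precedes w v" if "(p', v) \<in> set (child_part j d)" for p' v
  proof -
    have "precedes (j # w) (j # v)"
      using 3(3) that by (auto simp: set_child_part)
    then show ?thesis by simp
  qed
  then show ?case using 3 by auto
qed auto

lemma sorted_shift:
  "sorted_wrt precedes (map snd (shift i d)) \<longleftrightarrow> sorted_wrt precedes (map snd d)"
  by (induction d) (auto simp: shift_def split_beta)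

lemma sorted_join:
  assumes "\<And>d. d \<in> set ds \<Longrightarrow> sorted_wrt precedes (map snd d)"
  shows "sorted_wrt precedes (map snd (join ds))"
proof -
  have "n \<le> length ds \<Longrightarrow>
    sorted_wrt precedes (map snd (concat (map (\<lambda>i. shift (Suc i) (ds ! i)) [0..<n])))" for n
  proof (induction n)
    case (Suc n)
    have "sorted_wrt precedes (map snd (shift (Suc n) (ds ! n)))"
      using assms Suc.prems by (simp add: sorted_shift)
    then show ?case
      using Suc by (auto simp: sorted_wrt_append shift_def)
  qed simp
  then show ?thesis by (simp add: join_def)
qed

lemma Nil_notin_join: "(p, []) \<notin> set (join ds)"
  by (auto simp: join_def shift_def)

text \<open>Sortedness puts all steps below a child before those below later children. Without steps
  at the root, the list is therefore the concatenation of its parts.\<close>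

lemma join_child_part:
  assumes "sorted_wrt precedes (map snd d)"
    and "\<And>p w. (p, w) \<in> set d \<Longrightarrow> \<exists>i<k. \<exists>v. w = Suc i # v"
  shows "join (map (\<lambda>i. child_part (Suc i) d) [0..<k]) = d"
proof -
  let ?F = "\<lambda>d i. shift (Suc i) (child_part (Suc i) d)"
  have "concat (map (?F d) [0..<k]) = d"
    using assms
  proof (induction d)
    case Nil
    then show ?case by (auto simp: shift_def)
  next
    case (Cons a d)
    obtain p i v where a: "a = (p, Suc i # v)" and i: "i < k"
      using Cons.prems(2) by (metis list.set_intros(1) surj_pair)
    have IH: "concat (map (?F d) [0..<k]) = d"
      using Cons.IH Cons.prems by auto
    \<comment> \<open>The first step lies below child \<open>Suc i\<close>, so a later step below an
      earlier child would violate sortedness. Hence \<open>a\<close> becomes the head of the first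
      nonempty block.\<close>
    have empty: "?F d j = []" if "j < i" for j
    proof -
      have False if "(p', w) \<in> set (child_part (Suc j) d)" for p' w
      proof -
        have "(p', Suc j # w) \<in> set d" using that by (simp add: set_child_part)
        then have "precedes (Suc i # v) (Suc j # w)" using Cons.prems(1) a by auto
        then show False using \<open>j < i\<close> by simp
      qed
      then have "child_part (Suc j) d = []"
        by (metis list.set_intros(1) neq_Nil_conv surj_pair)
      then show ?thesis by (simp add: shift_def)
    qed
    have split: "[0..<k] = [0..<i] @ i # [Suc i..<k]"
      using i by (metis upt_conv_Cons upt_add_eq_append[of 0 i "k - i"] le_add_diff_inverse
          less_imp_le_nat le0)
    have c0: "concat (map (?F d) [0..<i]) = []" "concat (map (?F (a # d)) [0..<i]) = []"
      using empty a by auto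
    have c1: "map (?F (a # d)) [Suc i..<k] = map (?F d) [Suc i..<k]"
      using a by auto
    have c2: "?F (a # d) i = a # ?F d i" using a by (simp add: shift_def)
    have "concat (map (?F (a # d)) [0..<k]) = a # concat (map (?F d) [0..<k])"
      unfolding split map_append concat_append c0 list.map concat.simps c1 c2 by simp
    then show ?case using IH by simp
  qed
  moreover have "map (\<lambda>i. shift (Suc i) (map (\<lambda>i. child_part (Suc i) d) [0..<k] ! i)) [0..<k]
      = map (?F d) [0..<k]"
    by simp
  ultimately show ?thesis by (simp only: join_def length_map length_upt diff_zero)
qed

section \<open>Rewriting steps below different children\<close>

lemma derives_append:
  "derives G t \<xi> (d @ e) \<zeta> \<longleftrightarrow> (\<exists>\<eta>. derives G t \<xi> d \<eta> \<and> derives G t \<eta> e \<zeta>)"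
proof (induction d arbitrary: \<xi>)
  case (Cons a d)
  then show ?case by (cases a) auto
qed simp

text \<open>A step below one child inspects and changes only that child's component of the input
  tree and the current tree, so steps below different children do not interact. As no step is at the
  root, the root symbol survives.\<close>

lemma derives_child_part:
  assumes "derives G (Fun f ts) (Fun f xs) d \<zeta>"
    and "\<And>p. (p, []) \<notin> set d" and "length xs = length ts"
  shows "\<exists>ys. \<zeta> = Fun f ys \<and> length ys = length ts \<and>
    (\<forall>i<length ts. derives G (ts ! i) (xs ! i) (child_part (Suc i) d) (ys ! i))"
  using assms
proof (induction d arbitrary: xs)
  case (Cons a d)
  obtain p j w where a: "a = (p, j # w)"
    using Cons.prems(2) by (metis list.set_intros(1) neq_Nil_conv surj_pair)
  obtain \<xi> where s: "step G (Fun f ts) p (j # w) (Fun f xs) \<xi>"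
    and d: "derives G (Fun f ts) \<xi> d \<zeta>"
    using Cons.prems(1) a by auto
  obtain i where j: "j = Suc i" and i: "i < length ts"
    using s Cons.prems(3) by (cases j) (auto simp: step_def)
  let ?x = "replace_at (xs ! i) w (Var (target p))"
  have \<xi>: "\<xi> = Fun f (xs[i := ?x])" using s j by (simp add: step_def)
  have si: "step G (ts ! i) p w (xs ! i) ?x"
    using s j by (auto simp: step_def)
  obtain ys where ys: "\<zeta> = Fun f ys" "length ys = length ts"
    "\<And>l. l < length ts \<Longrightarrow> derives G (ts ! l) (xs[i := ?x] ! l) (child_part (Suc l) d) (ys ! l)"
    using Cons.IH[OF d[unfolded \<xi>]] Cons.prems by auto
  have "derives G (ts ! l) (xs ! l) (child_part (Suc l) (a # d)) (ys ! l)"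
    if "l < length ts" for l
    using ys(3)[OF that] si a j i Cons.prems(3) by (auto simp: nth_list_update split: if_splits)
  then show ?case using ys by blast
qed auto

lemma derives_shift:
  assumes "derives G (ts ! i) (xs ! i) d y" "i < length ts" "length xs = length ts"
  shows "derives G (Fun f ts) (Fun f xs) (shift (Suc i) d) (Fun f (xs[i := y]))"
  using assms
proof (induction d arbitrary: xs)
  case Nil
  then show ?case by (auto simp: shift_def)
next
  case (Cons a d)
  obtain p w where a: "a = (p, w)" by (cases a)
  obtain x where s: "step G (ts ! i) p w (xs ! i) x" and d: "derives G (ts ! i) x d y"
    using Cons.prems(1) a by auto
  have "step G (Fun f ts) p (Suc i # w) (Fun f xs) (Fun f (xs[i := x]))"
    using s Cons.prems by (auto simp: step_def)
  moreover have "derives G (Fun f ts) (Fun f (xs[i := x])) (shift (Suc i) d) (Fun f (xs[i := y]))"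
    using Cons.IH[of "xs[i := x]"] d Cons.prems by simp
  ultimately show ?case using a by (auto simp: shift_def)
qed

lemma derives_join:
  assumes "length ds = length ts" "length xs = length ts" "length ys = length ts"
    and "\<And>i. i < length ts \<Longrightarrow> derives G (ts ! i) (xs ! i) (ds ! i) (ys ! i)"
  shows "derives G (Fun f ts) (Fun f xs) (join ds) (Fun f ys)"
proof -
  \<comment> \<open>After \<open>n\<close> rounds the first \<open>n\<close> children are completely
    rewritten and the others untouched.\<close>
  have "n \<le> length ts \<Longrightarrow> derives G (Fun f ts) (Fun f xs)
    (concat (map (\<lambda>i. shift (Suc i) (ds ! i)) [0..<n])) (Fun f (take n ys @ drop n xs))" for n
  proof (induction n)
    case (Suc n)
    have "derives G (Fun f ts) (Fun f (take n ys @ drop n xs)) (shift (Suc n) (ds ! n))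
        (Fun f ((take n ys @ drop n xs)[n := ys ! n]))"
      using Suc.prems assms by (intro derives_shift) (auto simp: nth_append)
    moreover have "(take n ys @ drop n xs)[n := ys ! n] = take (Suc n) ys @ drop (Suc n) xs"
      using Suc.prems assms
      by (intro nth_equalityI) (auto simp: nth_append nth_list_update less_Suc_eq)
    ultimately show ?case using Suc by (auto simp: derives_append)
  qed simp
  from this[of "length ts"] show ?thesis using assms(1-3) by (simp add: join_def)
qed

section \<open>Left-most derivations at a node\<close>

definition admits :: "('f, 'z) tree \<Rightarrow> ('q, 'f) production \<Rightarrow> bool" where
  "admits t p \<longleftrightarrow> (\<forall>c\<in>eqs p. satisfies t c) \<and> (\<forall>c\<in>neqs p. \<not> satisfies t c)"

text \<open>These are the candidates for the last step at a root \<open>f\<close>. The list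
  \<open>qs\<close> is determined by the production (\<open>rules_unique\<close>) and carried along
  for the recursion on subtrees. The open variable type lets \<open>rules_embed\<close> return from
  embedded trees to ground trees.\<close>

definition rules :: "('q, 'f, 's) grammar \<Rightarrow> 'q \<Rightarrow> 'f \<Rightarrow> ('f, 'z) tree list \<Rightarrow>
    (('q, 'f) production \<times> 'q list) set" where
  "rules G q f ts = {(p, qs). p \<in> prods G \<and> target p = q \<and> lhs p = Fun f (map Var qs) \<and>
     length qs = length ts \<and> admits (Fun f ts) p}"

lemma map_Var_eq_iff: "map Var xs = map Var ys \<longleftrightarrow> xs = ys"
  by (rule inj_map_eq_map) (simp add: inj_def)

lemma rules_unique:
  fixes G :: "('q, 'f, 's) grammar"
  assumes "(p, qs) \<in> rules G q f ts" "(p, qs') \<in> rules G q f ts"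
  shows "qs = qs'"
proof -
  have "lhs p = Fun f (map Var qs)" "lhs p = Fun f (map Var qs')"
    using assms by (simp_all add: rules_def)
  then have "(Fun f (map Var qs) :: ('f, 'q) tree) = Fun f (map Var qs')" by (rule trans[OF sym])
  then show ?thesis by (simp add: map_Var_eq_iff)
qed

lemma finite_rules:
  assumes "finite (prods G)"
  shows "finite (rules G q f ts)"
proof (rule inj_on_finite)
  show "inj_on fst (rules G q f ts)"
    by (rule inj_onI) (metis prod.collapse rules_unique)
  show "fst ` rules G q f ts \<subseteq> prods G" by (auto simp: rules_def)
qed fact

lemma listset_iff:
  "xs \<in> listset As \<longleftrightarrow> length xs = length As \<and> (\<forall>i<length As. xs ! i \<in> As ! i)"
proof (induction As arbitrary: xs)
  case (Cons A As)
  then show ?case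
    by (cases xs) (auto simp: set_Cons_def nth_Cons split: nat.splits)
qed auto

abbreviation (input) run_data where
  "run_data G q f ts \<equiv>
     (SIGMA (p, qs) : rules G q f ts. listset (map2 (leftmost_derivations G) qs ts))"

text \<open>A normalized left-hand side has only nonterminals below its root symbol, so every child
  is rewritten to a nonterminal before the root step. What precedes that step splits uniquely into
  left-most derivations of the subtrees.\<close>

lemma leftmost_derivations_Fun:
  assumes normal: "\<forall>p\<in>prods G. \<exists>f qs. lhs p = Fun f (map Var qs)"
  shows "bij_betw (\<lambda>((p, qs), ds). join ds @ [(p, [])]) (run_data G q f ts)
    (leftmost_derivations G q (Fun f ts))"
  unfolding bij_betw_def
proof (intro conjI inj_onI equalityI subsetI)
  fix x y assume x: "x \<in> run_data G q f ts" and y: "y \<in> run_data G q f ts"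
    and eq: "(\<lambda>((p, qs), ds). join ds @ [(p, [])]) x = (\<lambda>((p, qs), ds). join ds @ [(p, [])]) y"
  obtain p qs ds where x_eq: "x = ((p, qs), ds)" by (metis surj_pair)
  obtain p' qs' ds' where y_eq: "y = ((p', qs'), ds')" by (metis surj_pair)
  have j: "join ds = join ds'" "p = p'" using eq x_eq y_eq by auto
  have "qs = qs'"
    using x y j(2) x_eq y_eq by (auto intro: rules_unique)
  moreover have "ds = ds'"
  proof (rule nth_equalityI)
    show l: "length ds = length ds'"
      using x y x_eq y_eq by (auto simp: rules_def listset_iff)
    show "ds ! i = ds' ! i" if "i < length ds" for i
      using that l j(1) by (metis child_part_join)
  qed
  ultimately show "x = y" using x_eq y_eq j by simp
next
  fix d assume "d \<in> (\<lambda>((p, qs), ds). join ds @ [(p, [])]) ` run_data G q f ts"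
  then obtain p qs ds where d: "d = join ds @ [(p, [])]" and r: "(p, qs) \<in> rules G q f ts"
    and ds: "ds \<in> listset (map2 (leftmost_derivations G) qs ts)" by auto
  have l: "length qs = length ts" "length ds = length ts"
    using r ds by (auto simp: rules_def listset_iff)
  have ld: "ds ! i \<in> leftmost_derivations G (qs ! i) (ts ! i)" if "i < length ts" for i
    using ds l that by (auto simp: listset_iff)
  have "derives G (Fun f ts) (Fun f ts) (join ds) (Fun f (map Var qs))"
    using ld l by (intro derives_join) (auto simp: leftmost_derivations_def)
  moreover have "step G (Fun f ts) p [] (Fun f (map Var qs)) (Var q)"
    using r by (auto simp: step_def rules_def admits_def)
  ultimately have "derives G (Fun f ts) (Fun f ts) d (Var q)"
    unfolding d derives_append by auto
  moreover have "sorted_wrt precedes (map snd (join ds))"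
    using ld l by (intro sorted_join) (auto simp: leftmost_derivations_def in_set_conv_nth)
  then have "sorted_wrt precedes (map snd d)"
    using Nil_notin_join[of _ ds] by (auto simp: d sorted_wrt_append)
  ultimately show "d \<in> leftmost_derivations G q (Fun f ts)"
    by (simp add: leftmost_derivations_def)
next
  fix d assume "d \<in> leftmost_derivations G q (Fun f ts)"
  then have der: "derives G (Fun f ts) (Fun f ts) d (Var q)"
    and sorted: "sorted_wrt precedes (map snd d)"
    by (auto simp: leftmost_derivations_def)
  have "d \<noteq> []" using der by auto
  then obtain e p w where d: "d = e @ [(p, w)]" by (metis rev_exhaust surj_pair)
  obtain \<xi> where e: "derives G (Fun f ts) (Fun f ts) e \<xi>"
    and s: "step G (Fun f ts) p w \<xi> (Var q)"
    using der by (auto simp: d derives_append)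
  \<comment> \<open>A step below the root would leave a symbol at the root, but the result is
    \<open>Var q\<close>.\<close>
  have w: "w = []"
  proof (cases w)
    case (Cons i v)
    then show ?thesis using s by (cases \<xi>) (auto simp: step_def)
  qed
  \<comment> \<open>The empty position precedes nothing, not even itself, so it occurs only in the
    last step.\<close>
  have nonempty: "(p', []) \<notin> set e" for p'
    using sorted by (auto simp: d sorted_wrt_append w)
  obtain ys where ys: "\<xi> = Fun f ys" "length ys = length ts"
    "\<And>i. i < length ts \<Longrightarrow> derives G (ts ! i) (ts ! i) (child_part (Suc i) e) (ys ! i)"
    using derives_child_part[OF e nonempty] by auto
  have p: "p \<in> prods G" "lhs p = \<xi>" "target p = q" "admits (Fun f ts) p"
    using s w by (auto simp: step_def admits_def)
  then obtain qs where qs: "ys = map Var qs" using normal ys(1) by (metis tree.inject(2))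
  have sorted_e: "sorted_wrt precedes (map snd e)"
    using sorted by (simp add: d sorted_wrt_append)
  let ?ds = "map (\<lambda>i. child_part (Suc i) e) [0..<length ts]"
  have "join ?ds = e"
  proof (rule join_child_part[OF sorted_e])
    fix p' v assume pv: "(p', v) \<in> set e"
    then have "v \<in> pos (Fun f ts)" using derives_pos[OF e] by auto
    moreover have "v \<noteq> []" using nonempty pv by blast
    ultimately show "\<exists>i<length ts. \<exists>u. v = Suc i # u"
      by (auto simp: Bex_def) (metis Suc_le_eq Suc_pred' less_eq_Suc_le)
  qed
  moreover have "(p, qs) \<in> rules G q f ts"
    using p ys qs by (auto simp: rules_def)
  moreover have "?ds \<in> listset (map2 (leftmost_derivations G) qs ts)"
    using ys qs sorted_child_part[OF sorted_e]
    by (auto simp: listset_iff leftmost_derivations_def)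
  ultimately have "((p, qs), ?ds) \<in> run_data G q f ts"
    and "d = (\<lambda>((p, qs), ds). join ds @ [(p, [])]) ((p, qs), ?ds)"
    unfolding d w by simp_all
  then show "d \<in> (\<lambda>((p, qs), ds). join ds @ [(p, [])]) ` run_data G q f ts"
    by (rule rev_image_eqI)
qed

section \<open>Annihilators in finitely generated monoids\<close>

inductive_set monoid_span :: "'s::comm_monoid_mult set \<Rightarrow> 's set" for A where
  one: "1 \<in> monoid_span A"
| mult: "a \<in> A \<Longrightarrow> x \<in> monoid_span A \<Longrightarrow> a * x \<in> monoid_span A"

lemma monoid_span_generator: "a \<in> A \<Longrightarrow> a \<in> monoid_span A"
  using monoid_span.mult[OF _ monoid_span.one] by simp

lemma monoid_span_mult:
  "x \<in> monoid_span A \<Longrightarrow> y \<in> monoid_span A \<Longrightarrow> x * y \<in> monoid_span A"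
  by (induction rule: monoid_span.induct) (auto simp: mult.assoc intro: monoid_span.mult)

lemma monoid_span_prod_list:
  "set xs \<subseteq> monoid_span A \<Longrightarrow> prod_list xs \<in> monoid_span A"
  by (induction xs) (auto intro: monoid_span.one monoid_span_mult)

text \<open>Splits off the power of one generator, for the induction on the generators in Dickson's
  lemma.\<close>

lemma monoid_span_insert:
  assumes "x \<in> monoid_span (insert a A)"
  shows "\<exists>k. \<exists>y\<in>monoid_span A. x = a ^ k * y"
  using assms
proof induction
  case one
  then show ?case by (intro exI[of _ 0] bexI[of _ 1]) (auto intro: monoid_span.one)
next
  case (mult b x)
  then obtain k y where y: "y \<in> monoid_span A" "x = a ^ k * y" by blast
  show ?case
  proof (cases "b = a")
    case True
    then show ?thesis
      using y by (intro exI[of _ "Suc k"] bexI[of _ y]) (auto simp: mult.assoc)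
  next
    case False
    then show ?thesis
      using y mult by (intro exI[of _ k] bexI[of _ "b * y"])
        (auto simp: mult.left_commute intro: monoid_span.mult)
  qed
qed

text \<open>Every sequence has a monotone subsequence. If that one is decreasing, it is constant
  from an index on at which its minimum is attained.\<close>

lemma nat_incseq_subseq:
  fixes f :: "nat \<Rightarrow> nat"
  shows "\<exists>r :: nat \<Rightarrow> nat. strict_mono r \<and> incseq (f \<circ> r)"
proof -
  obtain r :: "nat \<Rightarrow> nat" where r: "strict_mono r" "monoseq (\<lambda>n. f (r n))"
    using seq_monosub[of f] by auto
  consider "incseq (\<lambda>n. f (r n))" | "decseq (\<lambda>n. f (r n))"
    using r(2) by (auto simp: monoseq_iff)
  then show ?thesis
  proof cases
    case 1
    then show ?thesis using r(1) by (auto simp: comp_def)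
  next
    case 2
    obtain m where m: "\<And>n. f (r m) \<le> f (r n)"
      using ex_has_least_nat[of "\<lambda>_. True" _ "\<lambda>n. f (r n)"] by auto
    have "f (r (m + n)) = f (r m)" for n
      using m[of "m + n"] decseqD[OF 2, of m "m + n"] by simp
    then have "incseq (f \<circ> (\<lambda>n. r (m + n)))" by (simp add: incseq_def)
    moreover have "strict_mono (\<lambda>n. r (m + n))"
      using r(1) by (simp add: strict_mono_def)
    ultimately show ?thesis by blast
  qed
qed

text \<open>This is Dickson's lemma, with divisibility in place of the order on exponent vectors.\<close>

lemma dvd_incseq_subseq:
  fixes A :: "'s::comm_monoid_mult set" and f :: "nat \<Rightarrow> 's"
  assumes "finite A" "range f \<subseteq> monoid_span A"
  shows "\<exists>r :: nat \<Rightarrow> nat. strict_mono r \<and> (\<forall>i j. i \<le> j \<longrightarrow> f (r i) dvd f (r j))"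
  using assms
proof (induction A arbitrary: f rule: finite_induct)
  case empty
  have "x = 1" if "x \<in> monoid_span {}" for x :: 's
    using that by induction auto
  then have one: "f n = 1" for n using empty by blast
  show ?case by (intro exI[of _ id]) (simp add: strict_mono_def one)
next
  case (insert a A)
  have "\<forall>n. \<exists>k y. y \<in> monoid_span A \<and> f n = a ^ k * y"
    using insert.prems monoid_span_insert by (metis range_subsetD)
  then obtain k y where y: "\<And>n. y n \<in> monoid_span A" and f: "\<And>n. f n = a ^ k n * y n"
    by metis
  \<comment> \<open>First the exponents of \<open>a\<close> are made weakly increasing, which
    persists in the further subsequence that the induction hypothesis yields for the remaining
    factors.\<close>
  obtain r :: "nat \<Rightarrow> nat" where r: "strict_mono r" "incseq (k \<circ> r)"
    using nat_incseq_subseq by blast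
  have "range (\<lambda>n. y (r n)) \<subseteq> monoid_span A" using y by auto
  from insert.IH[OF this] obtain s :: "nat \<Rightarrow> nat"
    where s: "strict_mono s" "\<And>i j. i \<le> j \<Longrightarrow> y (r (s i)) dvd y (r (s j))"
    by blast
  have "f (r (s i)) dvd f (r (s j))" if "i \<le> j" for i j
    unfolding f
  proof (rule mult_dvd_mono[OF _ s(2)[OF that]])
    have "k (r (s i)) \<le> k (r (s j))"
      using r(2) that s(1) by (auto simp: incseq_def strict_mono_less_eq)
    then show "a ^ k (r (s i)) dvd a ^ k (r (s j))"
      by (metis dvdI le_add_diff_inverse power_add)
  qed
  moreover have "strict_mono (r \<circ> s)" using r s by (simp add: strict_mono_o)
  ultimately show ?case by (metis comp_apply)
qed

section \<open>Finiteness and compatibility of annihilators\<close>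

definition annihilator :: "'s::{comm_semiring_0, comm_monoid_mult} set \<Rightarrow> 's \<Rightarrow> 's set" where
  "annihilator M x = {z \<in> M. z * x = 0}"

lemma mult_zero_dvd:
  fixes x y z :: "'s::{comm_semiring_0, comm_monoid_mult}"
  assumes "z * x = 0" "x dvd y"
  shows "z * y = 0"
  using assms by (auto simp: dvd_def mult.assoc[symmetric])

text \<open>
  If there were infinitely many annihilators, Dickson's lemma would yield a strictly increasing
  sequence of them. A second application, to witnesses of strictness, gives a contradiction.
\<close>

lemma finite_annihilators:
  fixes A :: "'s::{comm_semiring_0, comm_monoid_mult} set"
  assumes "finite A"
  shows "finite (annihilator (monoid_span A) ` monoid_span A)"
proof (rule ccontr)
  let ?M = "monoid_span A"
  assume "infinite (annihilator ?M ` ?M)"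
  then obtain g :: "nat \<Rightarrow> 's set" where g: "inj g" "range g \<subseteq> annihilator ?M ` ?M"
    using infinite_countable_subset by blast
  then have "\<forall>n. \<exists>x\<in>?M. g n = annihilator ?M x" by blast
  then obtain x where x: "\<And>n. x n \<in> ?M" "\<And>n. g n = annihilator ?M (x n)" by metis
  obtain r :: "nat \<Rightarrow> nat" where r: "strict_mono r" "\<And>i j. i \<le> j \<Longrightarrow> x (r i) dvd x (r j)"
    using dvd_incseq_subseq[OF assms, of x] x(1) by blast
  have "\<exists>z\<in>?M. z * x (r (Suc n)) = 0 \<and> z * x (r n) \<noteq> 0" for n
  proof -
    have "annihilator ?M (x (r n)) \<noteq> annihilator ?M (x (r (Suc n)))"
      using g(1) r(1) x(2) by (metis injD n_not_Suc_n strict_mono_eq)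
    \<comment> \<open>Annihilators grow along divisibility, so two distinct consecutive ones have a
      witness in their difference.\<close>
    moreover have "annihilator ?M (x (r n)) \<subseteq> annihilator ?M (x (r (Suc n)))"
      using mult_zero_dvd r(2)[of n "Suc n"] by (auto simp: annihilator_def)
    ultimately show ?thesis by (auto simp: annihilator_def)
  qed
  then obtain z where z: "\<And>n. z n \<in> ?M" "\<And>n. z n * x (r (Suc n)) = 0"
    "\<And>n. z n * x (r n) \<noteq> 0"
    by metis
  obtain s :: "nat \<Rightarrow> nat" where s: "strict_mono s" "\<And>i j. i \<le> j \<Longrightarrow> z (s i) dvd z (s j)"
    using dvd_incseq_subseq[OF assms, of z] z(1) by blast
  \<comment> \<open>The witness \<open>z (s 0)\<close> kills \<open>x (r (Suc (s 0)))\<close> and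
    hence its multiple \<open>x (r (s 1))\<close>. So does \<open>z (s 1)\<close>, being a multiple
    of \<open>z (s 0)\<close>, which contradicts its choice.\<close>
  have "Suc (s 0) \<le> s 1" using s(1) by (simp add: strict_mono_def Suc_leI)
  then have "z (s 0) * x (r (s 1)) = 0"
    using z(2) r(2) mult_zero_dvd by blast
  then have "z (s 1) * x (r (s 1)) = 0"
    using s(2)[of 0 1] mult_zero_dvd by (metis mult.commute zero_le)
  then show False using z(3) by blast
qed

text \<open>The factors are exchanged one at a time: \<open>z * x\<close> is tested against
  \<open>y\<close>, then \<open>z * y'\<close> against \<open>x\<close>. These multipliers must lie
  in \<open>M\<close>, hence the assumptions on \<open>x\<close> and \<open>y'\<close>.\<close>

lemma annihilator_mult_cong:
  assumes "annihilator M x = annihilator M x'" "annihilator M y = annihilator M y'"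
    and "\<And>u v. u \<in> M \<Longrightarrow> v \<in> M \<Longrightarrow> u * v \<in> M" "x \<in> M" "y' \<in> M"
  shows "annihilator M (x * y) = annihilator M (x' * y')"
proof -
  have "z * (x * y) = 0 \<longleftrightarrow> z * (x' * y') = 0" if "z \<in> M" for z
  proof -
    have "z * (x * y) = 0 \<longleftrightarrow> z * x \<in> annihilator M y"
      using assms(3-) that by (simp add: annihilator_def mult.assoc)
    also have "\<dots> \<longleftrightarrow> z * x \<in> annihilator M y'" by (simp add: assms)
    also have "\<dots> \<longleftrightarrow> z * y' \<in> annihilator M x"
      using assms(3-) that by (simp add: annihilator_def mult_ac)
    also have "\<dots> \<longleftrightarrow> z * y' \<in> annihilator M x'" by (simp add: assms)
    also have "\<dots> \<longleftrightarrow> z * (x' * y') = 0"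
      using assms(3-) that by (simp add: annihilator_def mult_ac)
    finally show ?thesis .
  qed
  then show ?thesis by (auto simp: annihilator_def)
qed

lemma annihilator_prod_list_cong:
  assumes "list_all2 (\<lambda>x y. x \<in> M \<and> y \<in> M \<and> annihilator M x = annihilator M y) xs ys"
    and "\<And>u v. u \<in> M \<Longrightarrow> v \<in> M \<Longrightarrow> u * v \<in> M" "1 \<in> M"
  shows "prod_list xs \<in> M \<and> prod_list ys \<in> M \<and>
    annihilator M (prod_list xs) = annihilator M (prod_list ys)"
  using assms(1)
proof (induction rule: list_all2_induct)
  case (Cons x xs y ys)
  then show ?case
    using assms(2) annihilator_mult_cong[of M x y "prod_list xs" "prod_list ys"] by auto
qed (auto simp: assms)

section \<open>Recursion for weights of derivations\<close>

lemma embed_Fun: "embed (Fun f ts) = Fun f (map embed ts)"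
  by (simp add: embed_def)

text \<open>Since \<open>unit\<close> has a single element, mapping all variables back to
  \<open>()\<close> undoes \<open>embed\<close>. Thanks to injectivity, constraints mean the same
  before and after embedding.\<close>

lemma inj_embed: "inj (embed :: ('f, unit) tree \<Rightarrow> ('f, 'z) tree)"
proof (rule injI)
  have "map_tree id (\<lambda>_. ()) (embed t :: ('f, 'z) tree) = t" for t :: "('f, unit) tree"
    by (simp add: embed_def tree.map_comp comp_def tree.map_ident_strong)
  then show "x = y" if "(embed x :: ('f, 'z) tree) = embed y" for x y
    using that by metis
qed

lemma pos_embed: "pos (embed t :: ('f, 'z) tree) = pos t"
proof (induction t)
  case (Fun f ts)
  then have "pos (embed (ts ! (i - 1)) :: ('f, 'z) tree) = pos (ts ! (i - 1))" if "i \<in> {1..length ts}" for i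
    using that by (intro Fun) (auto intro: nth_mem)
  then show ?case by (auto simp: embed_Fun)
qed (simp add: embed_def)

lemma subtree_at_embed: "w \<in> pos t \<Longrightarrow> subtree_at (embed t) w = embed (subtree_at t w)"
proof (induction t w rule: subtree_at.induct)
  case (2 f ts i w)
  then show ?case by (auto simp: embed_Fun)
qed auto

lemma satisfies_embed: "satisfies (embed t) c \<longleftrightarrow> satisfies t c"
  by (auto simp: satisfies_def pos_embed subtree_at_embed inj_eq[OF inj_embed])

lemma rules_embed: "rules G q f (map embed ts) = rules G q f ts"
  by (simp add: rules_def admits_def embed_Fun[symmetric] satisfies_embed)

lemma derivation_weight_shift: "derivation_weight G (shift i d) = derivation_weight G d"
  by (induction d) (auto simp: derivation_weight_def shift_def)

lemma derivation_weight_append: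
  "derivation_weight G (d @ e) = derivation_weight G d * derivation_weight G e"
  by (simp add: derivation_weight_def)

lemma derivation_weight_join:
  "derivation_weight G (join ds) = prod_list (map (derivation_weight G) ds)"
proof -
  have "derivation_weight G (concat (map (\<lambda>i. shift (Suc i) (ds ! i)) is))
      = (\<Prod>i\<leftarrow>is. derivation_weight G (ds ! i))" for "is"
    by (induction "is") (simp_all add: derivation_weight_append derivation_weight_shift,
        simp add: derivation_weight_def)
  moreover have "map (derivation_weight G) ds = map (\<lambda>i. derivation_weight G (ds ! i)) [0..<length ds]"
    by (intro nth_equalityI) auto
  ultimately show ?thesis by (simp add: join_def)
qed

text \<open>This is the distributive law: expanding a product of sums picks one element from each
  set.\<close>

lemma sum_listset:
  fixes h :: "'a \<Rightarrow> 's :: {comm_semiring_0, comm_monoid_mult}"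
  assumes "\<And>A. A \<in> set As \<Longrightarrow> finite A"
  shows "(\<Sum>xs\<in>listset As. prod_list (map h xs)) = prod_list (map (sum h) As)"
  using assms
proof (induction As)
  case (Cons A As)
  have "bij_betw (\<lambda>(x, xs). x # xs) (A \<times> listset As) (listset (A # As))"
    by (auto simp: bij_betw_def inj_on_def set_Cons_def)
  then have "(\<Sum>xs\<in>listset (A # As). prod_list (map h xs))
      = (\<Sum>(x, xs)\<in>A \<times> listset As. h x * prod_list (map h xs))"
    by (subst sum.reindex_bij_betw[symmetric, where h = "\<lambda>(x, xs). x # xs"])
      (auto simp: split_beta)
  also have "\<dots> = sum h A * (\<Sum>xs\<in>listset As. prod_list (map h xs))"
    by (simp add: sum_product sum.cartesian_product)
  finally show ?case using Cons by simp
qed simp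

lemma finite_listset: "(\<And>A. A \<in> set As \<Longrightarrow> finite A) \<Longrightarrow> finite (listset As)"
proof (induction As)
  case (Cons A As)
  have "listset (A # As) = (\<lambda>(x, xs). x # xs) ` (A \<times> listset As)"
    by (auto simp: set_Cons_def)
  then show ?case using Cons by simp
qed simp

definition runs_weight :: "('q, 'f, 's::{comm_semiring_0, comm_monoid_mult}) grammar \<Rightarrow> 'q \<Rightarrow>
    ('f, unit) tree \<Rightarrow> 's" where
  "runs_weight G q t = (\<Sum>d\<in>leftmost_derivations G q (embed t). derivation_weight G d)"

text \<open>For \<open>G'\<close> it only matters whether sums of weights vanish. In a zero-sum free
  semiring multiplicities do not affect this, so a set of values takes the place of
  \<open>runs_weight\<close>.\<close>

definition run_values :: "('q, 'f, 's::comm_monoid_mult) grammar \<Rightarrow> 'q \<Rightarrow>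
    ('f, unit) tree \<Rightarrow> 's set" where
  "run_values G q t = derivation_weight G ` leftmost_derivations G q (embed t)"

text \<open>The bijection \<open>leftmost_derivations_Fun\<close> turns the sum over derivations
  into one over root productions and tuples of derivations of the subtrees; distributivity factors
  the inner sum.\<close>

lemma runs_weight_Fun:
  fixes G :: "('q, 'f, 's::{comm_semiring_0, comm_monoid_mult}) grammar"
  assumes fin: "finite (prods G)"
    and normal: "\<forall>p\<in>prods G. \<exists>f qs. lhs p = Fun f (map Var qs)"
  shows "runs_weight G q (Fun f ts)
    = (\<Sum>(p, qs)\<in>rules G q f ts. weight G p * prod_list (map2 (runs_weight G) qs ts))"
proof -
  let ?ts = "map embed ts :: ('f, 'q) tree list"
  let ?L = "\<lambda>qs. listset (map2 (leftmost_derivations G) qs ?ts)"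
  have fin_LD: "finite (leftmost_derivations G q t)" for q t
    by (rule finite_leftmost_derivations[OF fin])
  have "runs_weight G q (Fun f ts)
      = (\<Sum>((p, qs), ds)\<in>run_data G q f ?ts. derivation_weight G (join ds @ [(p, [])]))"
    unfolding runs_weight_def embed_Fun
    by (subst sum.reindex_bij_betw[OF leftmost_derivations_Fun[OF normal], symmetric])
      (auto simp: split_beta)
  also have "\<dots> = (\<Sum>x\<in>rules G q f ?ts. \<Sum>ds\<in>?L (snd x). derivation_weight G (join ds @ [(fst x, [])]))"
    by (subst sum.Sigma)
      (auto simp: case_prod_unfold finite_rules[OF fin] intro!: finite_listset fin_LD dest: set_zip_rightD
         elim!: in_set_zipE)
  also have "\<dots> = (\<Sum>x\<in>rules G q f ?ts. weight G (fst x) * prod_list (map2 (runs_weight G) (snd x) ts))"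
  proof (rule sum.cong[OF refl])
    fix x
    have "(\<Sum>ds\<in>?L (snd x). derivation_weight G (join ds @ [(fst x, [])]))
        = weight G (fst x) * (\<Sum>ds\<in>?L (snd x). prod_list (map (derivation_weight G) ds))"
      by (simp add: sum_distrib_left derivation_weight_append derivation_weight_join mult.commute)
        (simp add: derivation_weight_def mult.commute)
    also have "(\<Sum>ds\<in>?L (snd x). prod_list (map (derivation_weight G) ds))
        = prod_list (map (sum (derivation_weight G)) (map2 (leftmost_derivations G) (snd x) ?ts))"
      by (rule sum_listset) (auto simp: fin_LD)
    also have "map (sum (derivation_weight G)) (map2 (leftmost_derivations G) (snd x) ?ts)
        = map2 (runs_weight G) (snd x) ts"
      by (rule nth_equalityI) (auto simp: runs_weight_def)
    finally show "(\<Sum>ds\<in>?L (snd x). derivation_weight G (join ds @ [(fst x, [])]))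
        = weight G (fst x) * prod_list (map2 (runs_weight G) (snd x) ts)" .
  qed
  finally show ?thesis by (simp add: rules_embed split_beta)
qed

text \<open>The same bijection at the level of sets: a tuple of values of the subtrees is realized
  by choosing a derivation for each entry.\<close>

lemma run_values_Fun:
  fixes G :: "('q, 'f, 's::comm_monoid_mult) grammar"
  assumes normal: "\<forall>p\<in>prods G. \<exists>f qs. lhs p = Fun f (map Var qs)"
  shows "run_values G q (Fun f ts)
    = {weight G p * prod_list xs |p qs xs. (p, qs) \<in> rules G q f ts \<and>
        list_all2 (\<lambda>x (r, t). x \<in> run_values G r t) xs (zip qs ts)}"
    (is "_ = ?R")
proof -
  let ?ts = "map embed ts :: ('f, 'q) tree list"
  let ?L = "\<lambda>qs. listset (map2 (leftmost_derivations G) qs ?ts)"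
  have L: "(\<exists>ds\<in>?L qs. xs = map (derivation_weight G) ds)
      \<longleftrightarrow> list_all2 (\<lambda>x (r, t). x \<in> run_values G r t) xs (zip qs ts)" for qs xs
  proof
    assume "\<exists>ds\<in>?L qs. xs = map (derivation_weight G) ds"
    then show "list_all2 (\<lambda>x (r, t). x \<in> run_values G r t) xs (zip qs ts)"
      by (auto simp: list_all2_conv_all_nth listset_iff run_values_def)
  next
    assume *: "list_all2 (\<lambda>x (r, t). x \<in> run_values G r t) xs (zip qs ts)"
    then have "\<forall>i<length xs. \<exists>d. d \<in> leftmost_derivations G (qs ! i) (embed (ts ! i)) \<and>
        xs ! i = derivation_weight G d"
      by (auto simp: list_all2_conv_all_nth run_values_def image_iff Bex_def)
    then obtain d where d: "\<And>i. i < length xs \<Longrightarrow>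
        d i \<in> leftmost_derivations G (qs ! i) (embed (ts ! i)) \<and> xs ! i = derivation_weight G (d i)"
      by metis
    have "map d [0..<length xs] \<in> ?L qs"
      using d * by (auto simp: listset_iff list_all2_conv_all_nth)
    moreover have "xs = map (derivation_weight G) (map d [0..<length xs])"
      using d by (intro nth_equalityI) auto
    ultimately show "\<exists>ds\<in>?L qs. xs = map (derivation_weight G) ds" by blast
  qed
  have weight: "derivation_weight G (join ds @ [(p, [])])
      = weight G p * prod_list (map (derivation_weight G) ds)" for ds p
    by (simp add: derivation_weight_append derivation_weight_join mult.commute)
      (simp add: derivation_weight_def mult.commute)
  have "leftmost_derivations G q (Fun f ?ts) = (\<lambda>((p, qs), ds). join ds @ [(p, [])]) ` run_data G q f ?ts"
    by (rule bij_betw_imp_surj_on[OF leftmost_derivations_Fun[OF normal], symmetric])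
  then have "run_values G q (Fun f ts)
      = (\<lambda>((p, qs), ds). derivation_weight G (join ds @ [(p, [])])) ` run_data G q f ?ts"
    by (simp add: run_values_def embed_Fun image_image case_prod_unfold)
  also have "\<dots> = {weight G p * prod_list xs |p qs xs. (p, qs) \<in> rules G q f ts \<and>
      (\<exists>ds\<in>?L qs. xs = map (derivation_weight G) ds)}"
    (is "?I = ?S")
  proof (intro equalityI subsetI)
    fix x assume "x \<in> ?I"
    then show "x \<in> ?S" by (auto simp: weight rules_embed)
  next
    fix x assume "x \<in> ?S"
    then obtain p qs ds where x: "x = weight G p * prod_list (map (derivation_weight G) ds)"
      and "((p, qs), ds) \<in> run_data G q f ?ts"
      by (auto simp: rules_embed)
    from this(2) show "x \<in> ?I" by (rule rev_image_eqI) (simp add: x weight)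
  qed
  also have "\<dots> = ?R" unfolding L ..
  finally show ?thesis .
qed

lemma sum_eq_0_iff_zero_sum_free:
  fixes h :: "'a \<Rightarrow> 's::comm_monoid_add"
  assumes "\<And>a b :: 's. a + b = 0 \<Longrightarrow> a = 0 \<and> b = 0" and "finite A"
  shows "sum h A = 0 \<longleftrightarrow> (\<forall>x\<in>A. h x = 0)"
  using assms(2) by (induction rule: finite_induct) (auto dest: assms(1))

text \<open>Zero-sum freeness enters here: contributions of different derivations cannot
  cancel.\<close>

lemma generated_eq_0_iff:
  fixes G :: "('q, 'f, 's::{comm_semiring_0, comm_monoid_mult}) grammar"
  assumes "\<And>a b :: 's. a + b = 0 \<Longrightarrow> a = 0 \<and> b = 0"
    and "finite (nonterms G)" "finite (prods G)"
  shows "generated G t = 0 \<longleftrightarrow> (\<forall>q\<in>nonterms G. \<forall>x\<in>run_values G q t. final G q * x = 0)"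
  using assms(2) finite_leftmost_derivations[OF assms(3)]
  by (simp add: generated_def run_values_def sum_eq_0_iff_zero_sum_free[OF assms(1)])

lemma generated_eq_sum_runs_weight:
  "generated G t = (\<Sum>q\<in>nonterms G. final G q * runs_weight G q t)"
  by (simp add: generated_def runs_weight_def sum_distrib_left)

section \<open>Restriction to the support\<close>

lemma wtac_production:
  assumes "wtac Sig rk G" "p \<in> prods G"
  obtains f qs where "f \<in> Sig" "length qs = rk f" "set qs \<subseteq> nonterms G"
    "lhs p = Fun f (map Var qs)"
  using assms by (auto simp: wtac_def normalized_def)

lemma wtac_lhs_nonterms:
  assumes "wtac Sig rk G" "p \<in> prods G" "lhs p = Fun f (map Var qs)"
  shows "set qs \<subseteq> nonterms G"
proof -
  obtain g rs where "set rs \<subseteq> nonterms G" "lhs p = Fun g (map Var rs)"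
    using wtac_production[OF assms(1,2)] by metis
  with assms(3) show ?thesis by (simp add: map_Var_eq_iff)
qed

text \<open>The positions allowed in classic constraints thus depend only on the rank of the root
  symbol, which lets \<open>classic_H\<close> move constraints between productions with the same
  symbol.\<close>

lemma pos_in_normalized:
  "set qs \<subseteq> Q \<Longrightarrow> pos_in (Inr ` Q) (Fun f (map Var qs)) = {[i] |i. i \<in> {1..length qs}}"
  by (auto simp: pos_in_def subset_iff Suc_le_eq)

lemma run_values_subset_monoid_span:
  fixes G :: "('q, 'f, 's::comm_monoid_mult) grammar"
  shows "run_values G q t \<subseteq> monoid_span (weight G ` prods G)"
proof
  fix x assume "x \<in> run_values G q t"
  then obtain d where x: "x = derivation_weight G d" and "set d \<subseteq> prods G \<times> pos (embed t :: ('f, 'q) tree)"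
    by (auto simp: run_values_def leftmost_derivations_def dest!: derives_pos)
  then have "set (map (\<lambda>(p, w). weight G p) d) \<subseteq> monoid_span (weight G ` prods G)"
    by (auto intro: monoid_span_generator)
  then show "x \<in> monoid_span (weight G ` prods G)"
    unfolding x derivation_weight_def by (rule monoid_span_prod_list)
qed

lemma monoid_span_mono: "A \<subseteq> B \<Longrightarrow> monoid_span A \<subseteq> monoid_span B"
proof
  fix x assume "A \<subseteq> B" "x \<in> monoid_span A"
  from this(2,1) show "x \<in> monoid_span B"
    by induction (auto intro: monoid_span.intros)
qed

lemma prod_list_eq_0:
  "0 \<in> set xs \<Longrightarrow> prod_list xs = (0 :: 's :: {comm_semiring_0, comm_monoid_mult})"
  by (induction xs) auto

section \<open>The grammar that tracks profiles\<close>

locale support_restriction =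
  fixes Sig :: "'f set" and rk :: "'f \<Rightarrow> nat"
    and G :: "('q, 'f, 's::{comm_semiring_0, comm_monoid_mult}) grammar"
    and G' :: "('r, 'f, 's) grammar"
  assumes zero_sum_free: "\<And>a b :: 's. a + b = 0 \<Longrightarrow> a = 0 \<and> b = 0"
    and finite_Sig: "finite Sig"
    and wtac_G: "wtac Sig rk G" and wtac_G': "wtac Sig rk G'"
begin

text \<open>The final weights are among the generators, so that the annihilator of \<open>x\<close>
  in \<open>M\<close> tells whether \<open>final G' r * x\<close> vanishes.\<close>

definition M :: "'s set" where
  "M = monoid_span (weight G' ` prods G' \<union> final G' ` nonterms G')"

definition profile :: "('f, unit) tree \<Rightarrow> ('r \<times> 's set) set" where
  "profile t = {(r, annihilator M x) |r x. r \<in> nonterms G' \<and> x \<in> run_values G' r t}"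

definition states :: "('q \<times> ('r \<times> 's set) set) set" where
  "states = nonterms G \<times> Pow (nonterms G' \<times> annihilator M ` M)"

text \<open>The nonterminals of \<open>H\<close> have type \<open>nat\<close> whatever those of
  \<open>G\<close> and \<open>G'\<close> are, so the finitely many states are numbered.\<close>

abbreviation enc :: "'q \<times> ('r \<times> 's set) set \<Rightarrow> nat" where
  "enc \<equiv> to_nat_on states"

abbreviation dec :: "nat \<Rightarrow> 'q \<times> ('r \<times> 's set) set" where
  "dec \<equiv> from_nat_into states"

text \<open>Collecting the constraints separately for each symbol keeps their positions within the
  rank of \<open>f\<close> in the classic case.\<close>

definition constraints :: "'f \<Rightarrow> constraint set" where
  "constraints f = (\<Union>p\<in>{p \<in> prods G. root_label (lhs p) = Inl f}. eqs p \<union> neqs p) \<union>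
     (\<Union>p\<in>{p \<in> prods G'. root_label (lhs p) = Inl f}. eqs p \<union> neqs p)"

text \<open>
  The entries of \<open>xs\<close> are arbitrary representatives of the annihilators in \<open>Ss\<close>, and the annihilator of
  the product does not depend on their choice.
\<close>

definition next_profile :: "'f \<Rightarrow> constraint set \<Rightarrow> ('r \<times> 's set) set list \<Rightarrow> ('r \<times> 's set) set" where
  "next_profile f C Ss = {(target p, annihilator M (weight G' p * prod_list xs)) |p rs xs.
     p \<in> prods G' \<and> lhs p = Fun f (map Var rs) \<and> length rs = length Ss \<and>
     eqs p \<subseteq> C \<and> neqs p \<inter> C = {} \<and>
     list_all2 (\<lambda>x (r, S). x \<in> M \<and> (r, annihilator M x) \<in> S) xs (zip rs Ss)}"

text \<open>Here \<open>C\<close> is the guessed set of satisfied constraints. The profile in the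
  target is computed from the guess and the profiles of the children; only \<open>q\<close> is
  free.\<close>

definition production :: "'f \<Rightarrow> ('q \<times> ('r \<times> 's set) set) list \<Rightarrow> constraint set \<Rightarrow> 'q \<Rightarrow>
    (nat, 'f) production" where
  "production f ss C q = Production (Fun f (map Var (map enc ss)))
     (enc (q, next_profile f C (map snd ss))) C (constraints f - C)"

text \<open>
  The productions of \<open>G\<close> that become equal once \<open>C\<close> replaces their constraints are merged, so their
  weights are added.
\<close>

definition H :: "(nat, 'f, 's) grammar" where
  "H = \<lparr>nonterms = enc ` states,
     final = (\<lambda>n. if \<exists>(r, a)\<in>snd (dec n). final G' r \<notin> a then final G (fst (dec n)) else 0),
     prods = {production f ss C q |f ss C q. f \<in> Sig \<and> set ss \<subseteq> states \<and> length ss = rk f \<and>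
       C \<subseteq> constraints f \<and> q \<in> nonterms G},
     weight = (\<lambda>h. \<Sum>p\<in>{p \<in> prods G. lhs p = map_tree id (fst \<circ> dec) (lhs h) \<and>
       target p = fst (dec (target h)) \<and> eqs p \<subseteq> eqs h \<and> neqs p \<inter> eqs h = {}}. weight G p)\<rparr>"

lemma prods_H: "prods H = {production f ss C q |f ss C q. f \<in> Sig \<and> set ss \<subseteq> states \<and>
    length ss = rk f \<and> C \<subseteq> constraints f \<and> q \<in> nonterms G}"
  by (simp add: H_def)

lemma nonterms_H: "nonterms H = enc ` states"
  by (simp add: H_def)

lemma finite_G: "finite (nonterms G)" "finite (prods G)"
  and finite_G': "finite (nonterms G')" "finite (prods G')"
  using wtac_G wtac_G' by (auto simp: wtac_def wtgc_def)

lemma normal_G: "\<forall>p\<in>prods G. \<exists>f qs. lhs p = Fun f (map Var qs)"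
  using wtac_production[OF wtac_G] by metis

lemma normal_G': "\<forall>p\<in>prods G'. \<exists>f qs. lhs p = Fun f (map Var qs)"
  using wtac_production[OF wtac_G'] by metis

text \<open>\<open>M\<close> is generated by finitely many weights, so
  \<open>finite_annihilators\<close> bounds the possible profiles.\<close>

lemma finite_states: "finite states"
  unfolding states_def M_def by (intro finite_cartesian_product finite_G finite_G'
    finite_Pow_iff[THEN iffD2] finite_annihilators finite_UnI finite_imageI)

lemma countable_states: "countable states"
  using finite_states by (rule countable_finite)

lemma enc_eq_iff: "s \<in> states \<Longrightarrow> s' \<in> states \<Longrightarrow> enc s = enc s' \<longleftrightarrow> s = s'"
  by (rule to_nat_on_inj[OF countable_states])

lemma dec_enc: "s \<in> states \<Longrightarrow> dec (enc s) = s"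
  by (rule from_nat_into_to_nat_on[OF countable_states])

lemma final_H:
  "(q, S) \<in> states \<Longrightarrow>
    final H (enc (q, S)) = (if \<exists>(r, a)\<in>S. final G' r \<notin> a then final G q else 0)"
  by (simp add: H_def dec_enc)

lemma map_enc_eq_iff:
  "set ss \<subseteq> states \<Longrightarrow> set ss' \<subseteq> states \<Longrightarrow> map enc ss = map enc ss' \<longleftrightarrow> ss = ss'"
  by (rule inj_on_map_eq_map)
    (auto intro: inj_on_subset[OF inj_on_to_nat_on[OF countable_states]])

lemma one_in_M: "1 \<in> M"
  and mult_in_M: "x \<in> M \<Longrightarrow> y \<in> M \<Longrightarrow> x * y \<in> M"
  and weight_in_M: "p \<in> prods G' \<Longrightarrow> weight G' p \<in> M"
  and final_in_M: "r \<in> nonterms G' \<Longrightarrow> final G' r \<in> M"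
  and prod_list_in_M: "set xs \<subseteq> M \<Longrightarrow> prod_list xs \<in> M"
  unfolding M_def
  by (auto intro: monoid_span.one monoid_span_mult monoid_span_generator monoid_span_prod_list)

lemma run_values_in_M: "x \<in> run_values G' r t \<Longrightarrow> x \<in> M"
  using run_values_subset_monoid_span[of G' r t]
    monoid_span_mono[of "weight G' ` prods G'" "weight G' ` prods G' \<union> final G' ` nonterms G'"]
  unfolding M_def by blast

lemma profile_in_states: "q \<in> nonterms G \<Longrightarrow> (q, profile t) \<in> states"
  by (auto simp: states_def profile_def run_values_in_M)

lemma next_profile_in_states:
  assumes "q \<in> nonterms G"
  shows "(q, next_profile f C Ss) \<in> states"
proof -
  have "target p \<in> nonterms G'" if "p \<in> prods G'" for p
    using that wtac_G' by (auto simp: wtac_def wtgc_def)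
  moreover have "set xs \<subseteq> M"
    if "list_all2 (\<lambda>x (r, S). x \<in> M \<and> (r, annihilator M x) \<in> S) xs ys" for xs ys
    using that by (induction rule: list_all2_induct) auto
  ultimately show ?thesis
    using assms unfolding states_def next_profile_def
    by (auto intro!: imageI mult_in_M weight_in_M prod_list_in_M)
qed

text \<open>All constraints of \<open>p\<close> belong to \<open>constraints f\<close>, so
  \<open>t\<close> matters only through the satisfied ones among them.\<close>

lemma admits_iff_G:
  assumes "p \<in> prods G" "lhs p = Fun f xs"
  shows "admits t p \<longleftrightarrow> eqs p \<subseteq> {c \<in> constraints f. satisfies t c} \<and>
    neqs p \<inter> {c \<in> constraints f. satisfies t c} = {}"
  using assms by (fastforce simp: admits_def constraints_def)

lemma admits_iff_G':
  assumes "p \<in> prods G'" "lhs p = Fun f xs"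
  shows "admits t p \<longleftrightarrow> eqs p \<subseteq> {c \<in> constraints f. satisfies t c} \<and>
    neqs p \<inter> {c \<in> constraints f. satisfies t c} = {}"
  using assms by (fastforce simp: admits_def constraints_def)

text \<open>Values of actual runs are admissible representatives, which gives one inclusion. For the
  other, arbitrary representatives are replaced by values of runs with the same
  annihilators.\<close>

lemma profile_Fun:
  "profile (Fun f ts) = next_profile f {c \<in> constraints f. satisfies (Fun f ts) c} (map profile ts)"
    (is "_ = next_profile f ?C _")
proof (intro equalityI subsetI)
  fix y assume "y \<in> profile (Fun f ts)"
  then obtain r x where y: "y = (r, annihilator M x)" and x: "x \<in> run_values G' r (Fun f ts)"
    by (auto simp: profile_def)
  obtain p rs xs where x_eq: "x = weight G' p * prod_list xs" and p: "(p, rs) \<in> rules G' r f ts"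
    and xs: "list_all2 (\<lambda>x (r, t). x \<in> run_values G' r t) xs (zip rs ts)"
    using x unfolding run_values_Fun[OF normal_G'] by blast
  have p': "p \<in> prods G'" "target p = r" "lhs p = Fun f (map Var rs)" "length rs = length ts"
    "admits (Fun f ts) p"
    using p by (auto simp: rules_def)
  have "set rs \<subseteq> nonterms G'"
    by (rule wtac_lhs_nonterms[OF wtac_G' p'(1,3)])
  then have "rs ! i \<in> nonterms G'" if "i < length ts" for i
    using that p'(4) by (auto simp: subset_iff)
  then have "list_all2 (\<lambda>x (r, S). x \<in> M \<and> (r, annihilator M x) \<in> S) xs (zip rs (map profile ts))"
    using xs p'(4) by (auto simp: list_all2_conv_all_nth profile_def intro: run_values_in_M)
  then show "y \<in> next_profile f ?C (map profile ts)"
    using p' admits_iff_G'[OF p'(1,3), of "Fun f ts"]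
    unfolding y x_eq next_profile_def by auto
next
  fix y assume "y \<in> next_profile f ?C (map profile ts)"
  then obtain p rs xs where y: "y = (target p, annihilator M (weight G' p * prod_list xs))"
    and p: "p \<in> prods G'" "lhs p = Fun f (map Var rs)" "length rs = length ts"
      "eqs p \<subseteq> ?C" "neqs p \<inter> ?C = {}"
    and xs: "list_all2 (\<lambda>x (r, S). x \<in> M \<and> (r, annihilator M x) \<in> S) xs (zip rs (map profile ts))"
    unfolding next_profile_def by auto
  have len: "length xs = length ts" using list_all2_lengthD[OF xs] p(3) by simp
  \<comment> \<open>Membership of the annihilator of \<open>xs ! i\<close> in a profile provides a
    run value with this annihilator.\<close>
  have "\<forall>i<length ts. \<exists>x. x \<in> run_values G' (rs ! i) (ts ! i) \<and> annihilator M (xs ! i) = annihilator M x"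
    using xs p(3) by (auto simp: list_all2_conv_all_nth profile_def) blast
  then obtain z where z: "\<And>i. i < length ts \<Longrightarrow> z i \<in> run_values G' (rs ! i) (ts ! i)"
    "\<And>i. i < length ts \<Longrightarrow> annihilator M (xs ! i) = annihilator M (z i)"
    by metis
  let ?zs = "map z [0..<length ts]"
  have "list_all2 (\<lambda>x y. x \<in> M \<and> y \<in> M \<and> annihilator M x = annihilator M y) xs ?zs"
    using xs z(2) len p(3) run_values_in_M[OF z(1)] by (auto simp: list_all2_conv_all_nth)
  then have "prod_list xs \<in> M \<and> prod_list ?zs \<in> M \<and>
      annihilator M (prod_list xs) = annihilator M (prod_list ?zs)"
    by (rule annihilator_prod_list_cong) (auto intro: mult_in_M one_in_M)
  then have "annihilator M (weight G' p * prod_list xs) = annihilator M (weight G' p * prod_list ?zs)"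
    using p(1) by (intro annihilator_mult_cong) (auto intro: mult_in_M weight_in_M)
  moreover have "weight G' p * prod_list ?zs \<in> run_values G' (target p) (Fun f ts)"
  proof -
    have "(p, rs) \<in> rules G' (target p) f ts"
      using p admits_iff_G'[OF p(1,2), of "Fun f ts"] by (simp add: rules_def)
    moreover have "list_all2 (\<lambda>x (r, t). x \<in> run_values G' r t) ?zs (zip rs ts)"
      using z p(3) by (auto simp: list_all2_conv_all_nth)
    ultimately show ?thesis unfolding run_values_Fun[OF normal_G'] by blast
  qed
  moreover have "target p \<in> nonterms G'"
    using p(1) wtac_G' by (auto simp: wtac_def wtgc_def)
  ultimately show "y \<in> profile (Fun f ts)"
    unfolding y profile_def by blast
qed

section \<open>Well-formedness of \<open>H\<close>\<close>

lemma finite_constraints: "finite (constraints f)"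
  using wtac_G wtac_G' by (auto simp: constraints_def wtac_def wtgc_def)

lemma finite_H: "finite (prods H)"
proof (rule finite_subset)
  let ?D = "SIGMA f:Sig. {ss. set ss \<subseteq> states \<and> length ss = rk f} \<times> Pow (constraints f) \<times> nonterms G"
  show "prods H \<subseteq> (\<lambda>(f, ss, C, q). production f ss C q) ` ?D"
    by (force simp: H_def)
  show "finite ((\<lambda>(f, ss, C, q). production f ss C q) ` ?D)"
    using finite_Sig finite_states finite_constraints finite_G
    by (intro finite_imageI finite_SigmaI finite_cartesian_product)
      (auto intro: finite_lists_length_eq)
qed

lemma wtac_H: "wtac Sig rk H"
proof -
  have "lhs h \<in> trees Sig rk (nonterms H) - Var ` nonterms H \<and> target h \<in> nonterms H \<and>
      finite (eqs h) \<and> finite (neqs h) \<and> normalized Sig rk (nonterms H) h"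
    if hH: "h \<in> prods H" for h
  proof -
    obtain f ss C q where h: "h = production f ss C q" and "f \<in> Sig" "set ss \<subseteq> states"
      "length ss = rk f" "C \<subseteq> constraints f" "q \<in> nonterms G"
      using hH unfolding prods_H by blast
    have enc: "enc s \<in> nonterms H" if "s \<in> set ss" for s
      using that \<open>set ss \<subseteq> states\<close> unfolding nonterms_H by blast
    have "lhs h \<in> trees Sig rk (nonterms H)"
      using \<open>f \<in> Sig\<close> \<open>length ss = rk f\<close>
      by (auto simp: h production_def intro!: trees.intros enc)
    moreover have "target h \<in> nonterms H"
      using \<open>q \<in> nonterms G\<close> by (simp add: h production_def nonterms_H next_profile_in_states)
    moreover have "normalized Sig rk (nonterms H) h"
      unfolding normalized_def
      using \<open>f \<in> Sig\<close> \<open>length ss = rk f\<close> enc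
      by (intro exI[of _ f] exI[of _ "map enc ss"]) (auto simp: h production_def)
    ultimately show ?thesis
      using h \<open>C \<subseteq> constraints f\<close> finite_constraints[of f]
      by (auto simp: production_def intro: finite_subset)
  qed
  moreover have "finite (nonterms H)" using finite_states by (simp add: H_def)
  ultimately show ?thesis using finite_H by (auto simp: wtac_def wtgc_def)
qed

text \<open>A production of \<open>H\<close> collects constraints of many productions. They share
  the root symbol, and for normalized left-hand sides the nonterminals sit exactly at the positions
  of length one up to its rank.\<close>

lemma classic_H:
  assumes "classic G" "classic G'"
  shows "classic H"
proof -
  have positions: "(v, v') \<in> {[i] |i. i \<in> {1..rk f}} \<times> {[i] |i. i \<in> {1..rk f}}"
    if K: "wtac Sig rk K" "classic K" and p: "p \<in> prods K" "root_label (lhs p) = Inl f"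
      "(v, v') \<in> eqs p \<union> neqs p"
    for K :: "('a, 'f, 's) grammar" and p v v' f
  proof -
    obtain g qs where qs: "length qs = rk g" "set qs \<subseteq> nonterms K" "lhs p = Fun g (map Var qs)"
      using wtac_production[OF K(1) p(1)] by metis
    then have "pos_in (Inr ` nonterms K) (lhs p) = {[i] |i. i \<in> {1..rk f}}"
      using pos_in_normalized[OF qs(2), of g] p(2) by simp
    moreover have "v \<in> pos_in (Inr ` nonterms K) (lhs p) \<and> v' \<in> pos_in (Inr ` nonterms K) (lhs p)"
      using K(2) p(1,3) unfolding classic_def by blast
    ultimately show ?thesis by simp
  qed
  have constraints: "constraints f \<subseteq> {[i] |i. i \<in> {1..rk f}} \<times> {[i] |i. i \<in> {1..rk f}}" for f
  proof
    fix c assume "c \<in> constraints f"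
    moreover obtain v v' where "c = (v, v')" by (cases c)
    ultimately show "c \<in> {[i] |i. i \<in> {1..rk f}} \<times> {[i] |i. i \<in> {1..rk f}}"
      using positions[OF wtac_G assms(1)] positions[OF wtac_G' assms(2)]
      unfolding constraints_def by blast
  qed
  show ?thesis
    unfolding classic_def
  proof (intro ballI)
    fix h c assume "h \<in> prods H" and c: "c \<in> eqs h \<union> neqs h"
    then obtain f ss C q where h: "h = production f ss C q" and ss: "set ss \<subseteq> states"
      "length ss = rk f" and "C \<subseteq> constraints f"
      unfolding prods_H by blast
    then have "c \<in> constraints f" using c by (auto simp: production_def)
    moreover have "set (map enc ss) \<subseteq> nonterms H"
      using ss(1) unfolding nonterms_H set_map by (rule image_mono)
    from pos_in_normalized[OF this, of f]
    have "pos_in (Inr ` nonterms H) (lhs h) = {[i] |i. i \<in> {1..rk f}}"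
      using ss(2) by (simp add: h production_def)
    ultimately show "case c of (v, v') \<Rightarrow> v \<in> pos_in (Inr ` nonterms H) (lhs h) \<and>
        v' \<in> pos_in (Inr ` nonterms H) (lhs h)"
      using constraints[of f] by auto
  qed
qed

section \<open>Weights computed by \<open>H\<close>\<close>

text \<open>The constraints in \<open>C\<close> must hold and the others in
  \<open>constraints f\<close> must fail, so only the true set of satisfied constraints passes. The
  choice of states for the children is all that remains.\<close>

lemma rules_H:
  assumes f: "f \<in> Sig" "length ts = rk f" and qS: "(q, S) \<in> states"
  shows "rules H (enc (q, S)) f ts =
    (\<lambda>ss. (production f ss {c \<in> constraints f. satisfies (Fun f ts) c} q, map enc ss)) `
      {ss. set ss \<subseteq> states \<and> length ss = length ts \<and>
        S = next_profile f {c \<in> constraints f. satisfies (Fun f ts) c} (map snd ss)}"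
    (is "_ = (\<lambda>ss. (production f ss ?C q, map enc ss)) ` ?SS")
proof (intro equalityI subsetI)
  fix x assume x: "x \<in> rules H (enc (q, S)) f ts"
  obtain h ns where x_eq: "x = (h, ns)" by (cases x)
  have h: "h \<in> prods H" "target h = enc (q, S)" "lhs h = Fun f (map Var ns)"
    "length ns = length ts" "admits (Fun f ts) h"
    using x by (auto simp: x_eq rules_def)
  obtain f' ss C q' where h_eq: "h = production f' ss C q'" and ss: "set ss \<subseteq> states"
    and C: "C \<subseteq> constraints f'" and q': "q' \<in> nonterms G"
    using h(1) unfolding prods_H by blast
  have lhs: "f' = f" "ns = map enc ss"
    using h(3) by (auto simp: h_eq production_def map_Var_eq_iff simp del: map_map)
  moreover have "C = ?C"
    using C h(5) lhs by (auto simp: h_eq production_def admits_def)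
  moreover have "(q', next_profile f' C (map snd ss)) = (q, S)"
    using h(2) enc_eq_iff[OF next_profile_in_states[OF q'] qS] by (simp add: h_eq production_def)
  ultimately show "x \<in> (\<lambda>ss. (production f ss ?C q, map enc ss)) ` ?SS"
    using ss h(4) by (auto simp: x_eq h_eq)
next
  fix x assume "x \<in> (\<lambda>ss. (production f ss ?C q, map enc ss)) ` ?SS"
  then obtain ss where x: "x = (production f ss ?C q, map enc ss)" and ss: "set ss \<subseteq> states"
    "length ss = length ts" "S = next_profile f ?C (map snd ss)"
    by auto
  have "production f ss ?C q \<in> prods H"
    using f ss qS unfolding prods_H states_def by auto
  moreover have "admits (Fun f ts) (production f ss ?C q)"
    by (auto simp: admits_def production_def)
  ultimately show "x \<in> rules H (enc (q, S)) f ts"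
    using ss by (simp add: x rules_def production_def)
qed

text \<open>Decoding and dropping the profiles recovers the left-hand side over \<open>G\<close>. By
  \<open>admits_iff_G\<close>, the merged productions are then exactly those applicable at the root
  of this tree.\<close>

lemma weight_production:
  assumes "set ss \<subseteq> states" "q \<in> nonterms G" "length ss = length ts"
  shows "weight H (production f ss {c \<in> constraints f. satisfies (Fun f ts) c} q)
    = (\<Sum>(p, qs)\<in>{x \<in> rules G q f ts. snd x = map fst ss}. weight G p)"
    (is "weight H ?h = _")
proof -
  have "map (fst \<circ> dec \<circ> enc) ss = map fst ss"
    using assms(1) by (auto simp: dec_enc subset_iff)
  then have lhs: "map_tree id (fst \<circ> dec) (lhs ?h) = Fun f (map Var (map fst ss))"
    by (simp add: production_def comp_def)
  have target: "fst (dec (target ?h)) = q"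
    using assms(2) by (simp add: production_def dec_enc next_profile_in_states)
  have "weight H ?h = (\<Sum>p\<in>{p \<in> prods G. lhs p = Fun f (map Var (map fst ss)) \<and> target p = q \<and>
      eqs p \<subseteq> eqs ?h \<and> neqs p \<inter> eqs ?h = {}}. weight G p)"
    unfolding H_def grammar.simps lhs target ..
  also have "\<dots> = (\<Sum>p\<in>{p. (p, map fst ss) \<in> rules G q f ts}. weight G p)"
  proof (rule sum.cong[OF _ refl], rule Collect_cong)
    fix p
    show "p \<in> prods G \<and> lhs p = Fun f (map Var (map fst ss)) \<and> target p = q \<and>
      eqs p \<subseteq> eqs ?h \<and> neqs p \<inter> eqs ?h = {} \<longleftrightarrow> (p, map fst ss) \<in> rules G q f ts"
      using admits_iff_G[of p f "map Var (map fst ss)" "Fun f ts"] assms(3)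
      by (auto simp: rules_def production_def)
  qed
  also have "\<dots> = (\<Sum>(p, qs)\<in>{x \<in> rules G q f ts. snd x = map fst ss}. weight G p)"
    by (rule sum.reindex_bij_witness[of _ fst "\<lambda>p. (p, map fst ss)"]) auto
  finally show ?thesis .
qed

text \<open>The invariant of the simulation: wrong profiles get weight zero, and the right one
  inherits the weight from \<open>G\<close>.\<close>

lemma runs_weight_H:
  assumes "t \<in> ground_trees Sig rk" "(q, S) \<in> states"
  shows "runs_weight H (enc (q, S)) t = (if S = profile t then runs_weight G q t else 0)"
  using assms
proof (induction arbitrary: q S rule: trees.induct)
  case (Fun f ts)
  let ?C = "{c \<in> constraints f. satisfies (Fun f ts) c}"
  let ?SS = "{ss. set ss \<subseteq> states \<and> length ss = length ts \<and> S = next_profile f ?C (map snd ss)}"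
  let ?K = "{qs. set qs \<subseteq> nonterms G \<and> length qs = length ts}"
  let ?w = "\<lambda>ss. weight H (production f ss ?C q) * prod_list (map2 (runs_weight H) (map enc ss) ts)"
  have q: "q \<in> nonterms G" using Fun.prems by (simp add: states_def)
  have normal_H: "\<forall>h\<in>prods H. \<exists>f qs. lhs h = Fun f (map Var qs)"
    using wtac_production[OF wtac_H] by metis
  have fin_SS: "finite ?SS"
    by (rule finite_subset[OF _ finite_lists_length_eq[OF finite_states, of "length ts"]]) auto
  have inj: "inj_on (\<lambda>ss. (production f ss ?C q, map enc ss)) ?SS"
    by (rule inj_onI) (simp add: map_enc_eq_iff)
  have "runs_weight H (enc (q, S)) (Fun f ts) = (\<Sum>ss\<in>?SS. ?w ss)"
    unfolding runs_weight_Fun[OF finite_H normal_H] rules_H[OF Fun(1,2) Fun.prems]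
    by (subst sum.reindex[OF inj]) simp
  \<comment> \<open>By induction, a wrong profile at a single child contributes a factor 0.\<close>
  also have "\<dots> = (\<Sum>ss\<in>{ss \<in> ?SS. map snd ss = map profile ts}. ?w ss)"
  proof (rule sum.mono_neutral_right[OF fin_SS])
    show "\<forall>ss\<in>?SS - {ss \<in> ?SS. map snd ss = map profile ts}. ?w ss = 0"
    proof
      fix ss assume "ss \<in> ?SS - {ss \<in> ?SS. map snd ss = map profile ts}"
      then have ss: "set ss \<subseteq> states" "length ss = length ts" "map snd ss \<noteq> map profile ts" by auto
      then obtain i where i: "i < length ts" "snd (ss ! i) \<noteq> profile (ts ! i)"
        by (auto simp: list_eq_iff_nth_eq)
      have "ss ! i \<in> states" using ss(1,2) i(1) by (metis nth_mem subsetD)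
      then have "runs_weight H (enc (ss ! i)) (ts ! i) = 0"
        using Fun.IH[of "ts ! i" "fst (ss ! i)" "snd (ss ! i)"] i by simp
      then have "map2 (runs_weight H) (map enc ss) ts ! i = 0" using ss i by simp
      then have "0 \<in> set (map2 (runs_weight H) (map enc ss) ts)"
        using ss(2) i(1) by (metis (no_types, lifting) length_map length_zip min.idem nth_mem)
      then show "?w ss = 0" by (simp add: prod_list_eq_0)
    qed
  qed auto
  also have "\<dots> = (if S = profile (Fun f ts) then runs_weight G q (Fun f ts) else 0)"
  proof (cases "S = profile (Fun f ts)")
    case False
    \<comment> \<open>By \<open>profile_Fun\<close>, the true profiles of the children lead only to
      the true profile of the tree.\<close>
    then have "{ss \<in> ?SS. map snd ss = map profile ts} = {}" by (auto simp: profile_Fun)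
    then show ?thesis using False by (simp only: sum.empty if_False)
  next
    case True
    have summand: "?w (zip qs (map profile ts))
        = (\<Sum>(p, qs)\<in>{x \<in> rules G q f ts. snd x = qs}. weight G p * prod_list (map2 (runs_weight G) qs ts))"
      if "qs \<in> ?K" for qs
    proof -
      let ?ss = "zip qs (map profile ts)"
      have ss: "set ?ss \<subseteq> states" "length ?ss = length ts" "map fst ?ss = qs"
        using that by (auto simp: set_zip profile_in_states subset_iff)
      have "map2 (runs_weight H) (map enc ?ss) ts = map2 (runs_weight G) qs ts"
      proof (rule nth_equalityI)
        fix i assume "i < length (map2 (runs_weight H) (map enc ?ss) ts)"
        then have i: "i < length ts" "i < length qs" using that by auto
        then have "(qs ! i, profile (ts ! i)) \<in> states"
          using that by (auto intro!: profile_in_states simp: subset_iff)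
        then show "map2 (runs_weight H) (map enc ?ss) ts ! i = map2 (runs_weight G) qs ts ! i"
          using Fun.IH[of "ts ! i" "qs ! i" "profile (ts ! i)"] i by simp
      qed (use that in simp)
      then have "?w ?ss = (\<Sum>(p, qs')\<in>{x \<in> rules G q f ts. snd x = qs}. weight G p)
          * prod_list (map2 (runs_weight G) qs ts)"
        using weight_production[OF ss(1) q ss(2), of f] ss(3) by simp
      also have "\<dots> = (\<Sum>(p, qs)\<in>{x \<in> rules G q f ts. snd x = qs}.
          weight G p * prod_list (map2 (runs_weight G) qs ts))"
        unfolding sum_distrib_right by (rule sum.cong) auto
      finally show ?thesis .
    qed
    \<comment> \<open>With the profiles fixed, a list of states amounts to a list of nonterminals of
      \<open>G\<close>.\<close>
    have "(\<Sum>ss\<in>{ss \<in> ?SS. map snd ss = map profile ts}. ?w ss)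
        = (\<Sum>qs\<in>?K. ?w (zip qs (map profile ts)))"
    proof (rule sum.reindex_bij_witness[of _ "\<lambda>qs. zip qs (map profile ts)" "map fst"])
      fix ss assume "ss \<in> {ss \<in> ?SS. map snd ss = map profile ts}"
      then have ss: "set ss \<subseteq> states" "length ss = length ts" "map snd ss = map profile ts" by auto
      from ss(3) show "zip (map fst ss) (map profile ts) = ss"
        by (metis zip_map_fst_snd)
      then show "?w (zip (map fst ss) (map profile ts)) = ?w ss" by simp
      show "map fst ss \<in> ?K" using ss by (auto simp: states_def)
    next
      fix qs assume "qs \<in> ?K"
      then show "map fst (zip qs (map profile ts)) = qs"
        "zip qs (map profile ts) \<in> {ss \<in> ?SS. map snd ss = map profile ts}"
        using True by (auto simp: set_zip profile_in_states subset_iff profile_Fun)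
    qed
    also have "\<dots> = (\<Sum>qs\<in>?K. \<Sum>(p, qs)\<in>{x \<in> rules G q f ts. snd x = qs}.
        weight G p * prod_list (map2 (runs_weight G) qs ts))"
      by (rule sum.cong[OF refl summand])
    \<comment> \<open>The double sum groups the rules of \<open>G\<close> by the nonterminals of
      their left-hand sides, undoing the merging.\<close>
    also have "\<dots> = (\<Sum>(p, qs)\<in>rules G q f ts. weight G p * prod_list (map2 (runs_weight G) qs ts))"
    proof (rule sum.group[OF finite_rules[OF finite_G(2)] finite_lists_length_eq[OF finite_G(1)]])
      show "snd ` rules G q f ts \<subseteq> ?K"
      proof
        fix qs assume "qs \<in> snd ` rules G q f ts"
        then obtain p where p: "p \<in> prods G" "lhs p = Fun f (map Var qs)" "length qs = length ts"
          by (auto simp: rules_def)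
        then show "qs \<in> ?K" using wtac_lhs_nonterms[OF wtac_G p(1,2)] by simp
      qed
    qed
    finally show ?thesis using True by (simp add: runs_weight_Fun[OF finite_G(2) normal_G])
  qed
  finally show ?case .
qed simp

lemma generated_H:
  assumes t: "t \<in> ground_trees Sig rk"
  shows "generated H t = restrict_to (generated G) (supp Sig rk (generated G')) t"
proof -
  let ?S = "Pow (nonterms G' \<times> annihilator M ` M)"
  let ?acc = "\<lambda>S. \<exists>(r, a)\<in>S. final G' r \<notin> a"
  have fin_S: "finite ?S" and fin_G: "finite (nonterms G)"
    unfolding M_def using finite_G finite_G' by (simp_all add: finite_annihilators)
  have supp: "?acc (profile t) \<longleftrightarrow> generated G' t \<noteq> 0"
  proof -
    \<comment> \<open>Acceptance asks for a run value of \<open>G'\<close> whose product with the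
      final weight is nonzero; by zero-sum freeness this characterizes the support.\<close>
    have "?acc (profile t) \<longleftrightarrow> (\<exists>r\<in>nonterms G'. \<exists>x\<in>run_values G' r t. final G' r \<notin> annihilator M x)"
      unfolding profile_def by blast
    also have "\<dots> \<longleftrightarrow> (\<exists>r\<in>nonterms G'. \<exists>x\<in>run_values G' r t. final G' r * x \<noteq> 0)"
      by (simp add: annihilator_def final_in_M)
    also have "\<dots> \<longleftrightarrow> generated G' t \<noteq> 0"
      using generated_eq_0_iff[OF zero_sum_free finite_G', of t] by blast
    finally show ?thesis .
  qed
  have "generated H t = (\<Sum>n\<in>enc ` states. final H n * runs_weight H n t)"
    unfolding generated_eq_sum_runs_weight by (simp add: H_def)
  also have "\<dots> = (\<Sum>s\<in>states. final H (enc s) * runs_weight H (enc s) t)"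
    by (rule sum.reindex_cong[of enc]) (auto simp: inj_on_def enc_eq_iff)
  also have "\<dots> = (\<Sum>(q, S)\<in>states. (if ?acc S then final G q else 0) *
      (if S = profile t then runs_weight G q t else 0))"
    by (rule sum.cong[OF refl]) (simp only: split_paired_all case_prod_conv final_H runs_weight_H[OF t])
  also have "\<dots> = (\<Sum>q\<in>nonterms G. \<Sum>S\<in>?S. (if ?acc S then final G q else 0) *
      (if S = profile t then runs_weight G q t else 0))"
    unfolding states_def by (rule sum.cartesian_product[symmetric])
  \<comment> \<open>For each \<open>q\<close>, only the true profile of \<open>t\<close> survives in
    the inner sum.\<close>
  also have "\<dots> = (\<Sum>q\<in>nonterms G. (if ?acc (profile t) then final G q else 0) * runs_weight G q t)"
  proof (rule sum.cong[OF refl])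
    fix q assume "q \<in> nonterms G"
    then have "profile t \<in> ?S" using profile_in_states[of q t] by (simp add: states_def)
    then show "(\<Sum>S\<in>?S. (if ?acc S then final G q else 0) * (if S = profile t then runs_weight G q t else 0))
        = (if ?acc (profile t) then final G q else 0) * runs_weight G q t"
      using fin_S by (simp add: if_distrib[of "\<lambda>x. _ * x"] sum.delta cong: if_cong)
  qed
  also have "\<dots> = restrict_to (generated G) (supp Sig rk (generated G')) t"
    using t supp by (simp add: restrict_to_def supp_def generated_eq_sum_runs_weight[of G])
  finally show ?thesis .
qed

end

theorem theorem3:
  fixes Sig :: "'f set" and rk :: "'f \<Rightarrow> nat"
  assumes zero_sum_free: "\<And>a b :: 's :: {comm_semiring_0, comm_monoid_mult}.
      a + b = 0 \<Longrightarrow> a = 0 \<and> b = 0"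
    and "finite Sig"
  shows "(\<forall>(G :: ('q, 'f, 's) grammar) (G' :: ('r, 'f, 's) grammar).
            wtac Sig rk G \<and> wtac Sig rk G' \<longrightarrow>
            (\<exists>H :: (nat, 'f, 's) grammar. wtac Sig rk H \<and>
               (\<forall>t\<in>ground_trees Sig rk.
                  generated H t = restrict_to (generated G) (supp Sig rk (generated G')) t)))
       \<and> (\<forall>(G :: ('q, 'f, 's) grammar) (G' :: ('r, 'f, 's) grammar).
            wtac Sig rk G \<and> classic G \<and> wtac Sig rk G' \<and> classic G' \<longrightarrow>
            (\<exists>H :: (nat, 'f, 's) grammar. wtac Sig rk H \<and> classic H \<and>
               (\<forall>t\<in>ground_trees Sig rk.
                  generated H t = restrict_to (generated G) (supp Sig rk (generated G')) t)))"
proof -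
  have restriction: "support_restriction Sig rk G G'" if "wtac Sig rk G" "wtac Sig rk G'"
    for G :: "('q, 'f, 's) grammar" and G' :: "('r, 'f, 's) grammar"
    unfolding support_restriction_def using that assms by blast
  show ?thesis
  proof (intro conjI allI impI; elim conjE)
    fix G :: "('q, 'f, 's) grammar" and G' :: "('r, 'f, 's) grammar"
    assume "wtac Sig rk G" "wtac Sig rk G'"
    then interpret support_restriction Sig rk G G' by (rule restriction)
    show "\<exists>H :: (nat, 'f, 's) grammar. wtac Sig rk H \<and> (\<forall>t\<in>ground_trees Sig rk.
        generated H t = restrict_to (generated G) (supp Sig rk (generated G')) t)"
      using wtac_H generated_H by blast
  next
    fix G :: "('q, 'f, 's) grammar" and G' :: "('r, 'f, 's) grammar"
    assume "wtac Sig rk G" "wtac Sig rk G'"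
    then interpret support_restriction Sig rk G G' by (rule restriction)
    assume classic: "classic G" "classic G'"
    show "\<exists>H :: (nat, 'f, 's) grammar. wtac Sig rk H \<and> classic H \<and> (\<forall>t\<in>ground_trees Sig rk.
        generated H t = restrict_to (generated G) (supp Sig rk (generated G')) t)"
      using wtac_H classic_H[OF classic] generated_H by blast
  qed
qed

end
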